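(* Let $n\ge2$, $0<s<1$, $0<p,q<\infty$, let $k$ be an integer with $1\le k<sp<n$, and let $u^*\in\dot{W}^{s,p}_q(\mathbb{R}^n)$. Let $K_{u^*}\in\mathbb{R}$ be the real number for which there is a set $E\subset\mathbb{R}^n$, $(p,s)$-thin at infinity, with $\lim_{x\to\infty,\,x\notin E}u^*(x)=K_{u^*}$ (such a number exists). Then, for each $(n-k)$-dimensional linear subspace $V^{n-k}\subset\mathbb{R}^n$, $u^*$ has limit $K_{u^*}$ at infinity along $\mathcal{H}^{n-k}$-almost every $k$-plane perpendicular to $V^{n-k}$.
   Context: For a measurable $u:\mathbb{R}^n\to\mathbb{R}$, set $[u]_{W^{s,p}_q(\mathbb{R}^n)}=\Big(\int_{\mathbb{R}^n}\Big(\int_{\mathbb{R}^n}\frac{|u(x)-u(y)|^q}{|x-y|^{n+sq}}\,dy\Big)^{p/q}dx\Big)^{1/p}$. A cube in $\mathbb{R}^n$ is a set $Q=[a_1,b_1)\times\cdots\times[a_n,b_n)$ with $b_1-a_1=\cdots=b_n-a_n>0$. For measurable a.e. finite $u$ and a measurable set $E$ of finite positive measure, the median is $m_u(E)=\sup\{M\in\mathbb{R}: |\{x\in E: u(x)<M\}|\le |E|/2\}$, where $|\cdot|$ is Lebesgue measure. The precise representative of $u$ is $u^*(x)=\limsup_{|Q|\to0,\ x\in Q}m_u(Q)=\inf_{\delta>0}\sup\{m_u(Q): Q \text{ a cube},\ x\in Q,\ |Q|<\delta\}$ (an extended real value), for every $x\in\mathbb{R}^n$; one has $u^*=u$ a.e.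 The space $\dot{W}^{s,p}_q(\mathbb{R}^n)$ is the collection of all precise representatives $u^*$ of measurable functions $u:\mathbb{R}^n\to\mathbb{R}$ with $[u]_{W^{s,p}_q(\mathbb{R}^n)}<\infty$. For $\lambda\in(0,\infty)$ the Hausdorff content is $\mathcal{H}^\lambda_\infty(A)=\inf\{\sum_{j}\operatorname{diam}(B_j)^\lambda: A\subset\bigcup_j B_j\}$ over countable covers; $\mathcal{H}^\lambda$ is the Hausdorff measure. A set $E\subset\mathbb{R}^n$ is $(p,s)$-thin at infinity if $\lim_{m\to\infty}\mathcal{H}^\lambda_\infty(E\cap B(0,m)^c)=0$ for every $\lambda\in(0,\infty)$ with $\lambda>n-sp$. The notation $\lim_{x\to\infty,\,x\notin E}u^*(x)=K$ means: for every $\varepsilon>0$ there is $R>0$ with $|u^*(x)-K|<\varepsilon$ for all $x\notin E$, $|x|>R$. For a $k$-dimensional affine subspace $P^k\subset\mathbb{R}^n$, $u^*$ has limit $c\in\mathbb{R}$ at infinity along $P^k$ if for every $\varepsilon>0$ there is $R>0$ such that $|u^*(x)-c|<\varepsilon$ whenever $x\in P^k$ and $|x|>R$. For an $(n-k)$-dimensional submanifold $M\subset\mathbb{R}^n$ and $x\in M$, let $P(x,M)=x+(T_xM)^\perp$ be the $k$-dimensional affine normal subspace of $M$ at $x$ (for $M=V^{n-k}$ this is $x+(V^{n-k})^\perp$). A property holds for $\mathcal{H}^{n-k}$-almost every $k$-plane perpendicular to $M$ if there is $F\subset M$ with $\mathcal{H}^{n-k}(F)=0$ such that the property holds for $P(x,M)$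 for every $x\in M\setminus F$. *)

theory Defs
  imports "HOL-Analysis.Analysis"
begin

section \<open>Gagliardo-type seminorm\<close>

text \<open>Powers of extended nonnegative reals; only used with exponent \<open>a > 0\<close>.\<close>

definition ennpowr :: "ennreal \<Rightarrow> real \<Rightarrow> ennreal" where
  "ennpowr x a = (if x = top then top else ennreal (enn2real x powr a))"

text \<open>On the diagonal \<open>x = y\<close> the integrand is \<open>0 / 0 = 0\<close>; this is a null set.\<close>

definition W_seminorm :: "real \<Rightarrow> real \<Rightarrow> real \<Rightarrow> (real ^ 'n \<Rightarrow> real) \<Rightarrow> ennreal" where
  "W_seminorm s p q u =
     ennpowr
       (\<integral>\<^sup>+ x. ennpowr
          (\<integral>\<^sup>+ y. ennreal (\<bar>u x - u y\<bar> powr q / norm (x - y) powr (real CARD('n) + s * q)) \<partial>lebesgue)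
          (p / q) \<partial>lebesgue)
       (1 / p)"

section \<open>Medians and the precise representative\<close>

definition half_open_cube :: "(real ^ 'n) set \<Rightarrow> bool" where
  "half_open_cube Q \<longleftrightarrow>
     (\<exists>a b. (\<exists>l>0. \<forall>i. b $ i - a $ i = l) \<and> Q = {x. \<forall>i. a $ i \<le> x $ i \<and> x $ i < b $ i})"

definition median :: "(real ^ 'n \<Rightarrow> real) \<Rightarrow> (real ^ 'n) set \<Rightarrow> real" where
  "median u E = Sup {M. measure lebesgue {x \<in> E. u x < M} \<le> measure lebesgue E / 2}"

definition precise_rep :: "(real ^ 'n \<Rightarrow> real) \<Rightarrow> real ^ 'n \<Rightarrow> ereal" where
  "precise_rep u x =
     (INF \<delta>\<in>{0<..}. SUP Q\<in>{Q. half_open_cube Q \<and> x \<in> Q \<and> measure lebesgue Q < \<delta>}.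
        ereal (median u Q))"

definition Wdot :: "real \<Rightarrow> real \<Rightarrow> real \<Rightarrow> (real ^ 'n \<Rightarrow> ereal) set" where
  "Wdot s p q = {precise_rep u | u. u \<in> borel_measurable lebesgue \<and> W_seminorm s p q u < top}"

section \<open>Hausdorff content and measure\<close>

text \<open>
  Coverings by arbitrary bounded sets; the boundedness condition only discards coverings of
  infinite cost, for which \<^const>\<open>diameter\<close> would not return the right value.
  Finite coverings are included, since \<open>B j\<close> may be empty, at cost \<open>0\<close>.
\<close>

definition hausdorff_content :: "real \<Rightarrow> 'a::metric_space set \<Rightarrow> ennreal" where
  "hausdorff_content l A =
     (INF B\<in>{B :: nat \<Rightarrow> 'a set. A \<subseteq> (\<Union>j. B j) \<and> (\<forall>j. bounded (B j))}.
        \<Sum>j. ennreal (diameter (B j) powr l))"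

definition hausdorff_measure :: "real \<Rightarrow> 'a::metric_space set \<Rightarrow> ennreal" where
  "hausdorff_measure l A =
     (SUP \<delta>\<in>{0<..}.
        INF B\<in>{B :: nat \<Rightarrow> 'a set. A \<subseteq> (\<Union>j. B j) \<and> (\<forall>j. bounded (B j) \<and> diameter (B j) \<le> \<delta>)}.
          \<Sum>j. ennreal (diameter (B j) powr l))"

section \<open>Limits at infinity\<close>

definition thin_at_infinity :: "real \<Rightarrow> real \<Rightarrow> (real ^ 'n) set \<Rightarrow> bool" where
  "thin_at_infinity p s E \<longleftrightarrow>
     (\<forall>l>0. l > real CARD('n) - s * p \<longrightarrow>
        (\<lambda>m::nat. hausdorff_content l (E \<inter> - ball 0 (real m))) \<longlonglongrightarrow> 0)"

definition has_limit_outside :: "(real ^ 'n \<Rightarrow> ereal) \<Rightarrow> (real ^ 'n) set \<Rightarrow> real \<Rightarrow> bool" where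
  "has_limit_outside f E K \<longleftrightarrow>
     (\<forall>\<epsilon>>0. \<exists>R>0. \<forall>x. x \<notin> E \<and> norm x > R \<longrightarrow> \<bar>f x - ereal K\<bar> < ereal \<epsilon>)"

definition has_thin_limit :: "real \<Rightarrow> real \<Rightarrow> (real ^ 'n \<Rightarrow> ereal) \<Rightarrow> real \<Rightarrow> bool" where
  "has_thin_limit p s f K \<longleftrightarrow> (\<exists>E. thin_at_infinity p s E \<and> has_limit_outside f E K)"

definition has_limit_along :: "(real ^ 'n \<Rightarrow> ereal) \<Rightarrow> (real ^ 'n) set \<Rightarrow> real \<Rightarrow> bool" where
  "has_limit_along f P c \<longleftrightarrow>
     (\<forall>\<epsilon>>0. \<exists>R>0. \<forall>x\<in>P. norm x > R \<longrightarrow> \<bar>f x - ereal c\<bar> < ereal \<epsilon>)"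

section \<open>Planes perpendicular to a linear subspace\<close>

definition normal_plane :: "real ^ 'n \<Rightarrow> (real ^ 'n) set \<Rightarrow> (real ^ 'n) set" where
  "normal_plane x V = (+) x ` (V\<^sup>\<bottom>)"

text \<open>The relevant Hausdorff measure has dimension \<open>dim V = n - k\<close>, \<open>k\<close> being the dimension of the planes.\<close>

definition almost_every_normal_plane :: "(real ^ 'n) set \<Rightarrow> ((real ^ 'n) set \<Rightarrow> bool) \<Rightarrow> bool" where
  "almost_every_normal_plane V P \<longleftrightarrow>
     (\<exists>F\<subseteq>V. hausdorff_measure (real (dim V)) F = 0 \<and> (\<forall>x\<in>V - F. P (normal_plane x V)))"

end

theory Submission
  imports Defs
begin

text \<open>
  The proof rests on one pointwise estimate. Let \<open>G z\<close> be the inner integral of the seminorm at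
  the point \<open>z\<close>, and let \<open>z\<close> and a set \<open>E\<close> lie in a common ball of radius \<open>r\<close>, with \<open>\<bar>E\<bar>\<close>
  comparable to \<open>r\<^sup>n\<close>. By Chebyshev's inequality the set of \<open>y \<in> E\<close> with \<open>\<bar>u z - u y\<bar> > t\<close> fills less
  than half of \<open>E\<close> as soon as \<open>t\<close> is a large multiple of \<open>r\<^sup>s (G z)\<^bsup>1/q\<^esup>\<close>; hence the median of \<open>u\<close> on
  \<open>E\<close> differs from \<open>u z\<close> by at most such a \<open>t\<close> (\<open>median_close_of_frac_energy\<close>). In each ball some
  point \<open>z\<close> has \<open>(G z)\<^bsup>p/q\<^esup>\<close> not much above the mean over the ball. Finiteness of the seminorm says that
  \<open>\<mu> = G\<^bsup>p/q\<^esup> dx\<close> is a finite measure, and so two sets of size comparable to a ball \<open>B\<close> of radius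
  \<open>r\<close> that contains them have medians within \<open>C (\<mu>(B) / r\<^bsup>n-sp\<^esup>)\<^bsup>1/p\<^esup>\<close> of each other
  (\<open>median_oscillation_le\<close>). Every positive \<open>q\<close> is covered, because medians need no integrability.

  Everything else uses only this oscillation bound, in the locale \<open>median_oscillation\<close>, by summing it along
  concentric balls with dyadic radii.

  Going up from radius \<open>1\<close>, the bound decays geometrically because \<open>sp < n\<close>. So the medians on
  balls around the origin converge to a number \<open>K\<close>, and since far from the origin \<open>\<mu>\<close> has little mass,
  the medians on unit balls tend to \<open>K\<close> at infinity (\<open>unit_ball_medians_converge\<close>).

  Going down from radius \<open>1\<close> at a point \<open>x\<close> with \<open>\<mu>(B(x,r)) \<le> \<eta> r\<^sup>l\<close> for all \<open>r \<le> 1\<close>, where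
  \<open>l > n - sp\<close>, the bound decays geometrically too, and the precise representative at \<open>x\<close> differs
  from the median on the unit ball by at most \<open>C \<eta>\<^bsup>1/p\<^esup>\<close>
  (\<open>precise_rep_near_unit_ball_median\<close>). By Vitali's covering lemma the other points far away have
  \<open>l\<close>-dimensional content at most \<open>C \<mu>(far away) / \<eta>\<close>
  (\<open>hausdorff_content_large_ball_measure\<close>). Thus for every \<open>\<epsilon>\<close> and every \<open>l > n - sp\<close> the set where the
  precise representative is not within \<open>\<epsilon>\<close> of \<open>K\<close> has vanishing content near infinity, and a diagonal
  argument makes a single thin set out of these (\<open>ex_thin_exceptional_set\<close>). The limit is unique because
  the complement of a ball has infinite \<open>n\<close>-dimensional content.

  Finally let \<open>E\<close> be thin and \<open>V\<close> of dimension \<open>n - k\<close>, which exceeds \<open>n - sp\<close>. A plane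
  perpendicular to \<open>V\<close> is harmless if it misses \<open>E\<close> outside some ball. The base points of the other planes lie,
  for each \<open>m\<close>, in the projection of \<open>E - B(0,m)\<close> to \<open>V\<close>. Projections do not
  increase content, so these base points form a set of content zero and hence of measure zero.
\<close>

section \<open>Hausdorff content and Hausdorff measure\<close>

lemma hausdorff_content_le:
  assumes "A \<subseteq> (\<Union>j. B j)" "\<forall>j::nat. bounded (B j)"
  shows "hausdorff_content l A \<le> (\<Sum>j. ennreal (diameter (B j) powr l))"
  unfolding hausdorff_content_def by (rule INF_lower) (use assms in auto)

lemma hausdorff_content_less_cover:
  fixes A :: "'a::metric_space set"
  assumes "hausdorff_content l A < c"
  obtains B :: "nat \<Rightarrow> 'a set" where "A \<subseteq> (\<Union>j. B j)" "\<forall>j. bounded (B j)"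
    "(\<Sum>j. ennreal (diameter (B j) powr l)) < c"
  using assms unfolding hausdorff_content_def INF_less_iff by auto

lemma hausdorff_content_mono:
  "A \<subseteq> A' \<Longrightarrow> hausdorff_content l A \<le> hausdorff_content l A'"
  unfolding hausdorff_content_def by (rule INF_superset_mono) auto

lemma hausdorff_content_empty [simp]: "hausdorff_content l {} = 0"
  using hausdorff_content_le[of "{}" "\<lambda>_. {}" l] by simp

lemma hausdorff_content_UN_le:
  fixes A :: "nat \<Rightarrow> 'a::metric_space set"
  shows "hausdorff_content l (\<Union>i. A i) \<le> (\<Sum>i. hausdorff_content l (A i))"
proof (rule ennreal_le_epsilon)
  fix e :: real
  assume fin: "(\<Sum>i. hausdorff_content l (A i)) < top" and "0 < e"
  have "\<exists>B. A i \<subseteq> (\<Union>j. B j) \<and> (\<forall>j::nat. bounded (B j)) \<and>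
      (\<Sum>j. ennreal (diameter (B j) powr l)) < hausdorff_content l (A i) + ennreal (e * (1/2)^Suc i)" for i
  proof -
    have "hausdorff_content l (A i) \<noteq> top"
      using ennreal_suminf_lessD[OF fin, of i] by auto
    then have "hausdorff_content l (A i) < hausdorff_content l (A i) + ennreal (e * (1/2)^Suc i)"
      using \<open>0 < e\<close> ennreal_add_left_cancel_less[of "hausdorff_content l (A i)" 0] by auto
    then show ?thesis
      unfolding hausdorff_content_def INF_less_iff by auto
  qed
  then obtain B where B: "\<And>i. A i \<subseteq> (\<Union>j. B i j)" "\<And>i j::nat. bounded (B i j)"
    "\<And>i. (\<Sum>j. ennreal (diameter (B i j) powr l)) < hausdorff_content l (A i) + ennreal (e * (1/2)^Suc i)"
    by metis
  define C where "C k = (case prod_decode k of (i, j) \<Rightarrow> B i j)" for k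
  have "x \<in> (\<Union>k. C k)" if "x \<in> A i" for x i
  proof -
    obtain j where "x \<in> B i j" using B(1) \<open>x \<in> A i\<close> by blast
    then show ?thesis by (intro UN_I[of "prod_encode (i, j)"]) (auto simp: C_def)
  qed
  then have "hausdorff_content l (\<Union>i. A i) \<le> (\<Sum>k. ennreal (diameter (C k) powr l))"
    by (intro hausdorff_content_le) (auto simp: C_def B(2) split: prod.split)
  also have "\<dots> = (\<Sum>i. \<Sum>j. ennreal (diameter (B i j) powr l))"
  proof -
    have "(\<Sum>k. ennreal (diameter (C k) powr l)) =
        (\<Sum>k. (\<lambda>(i, j). ennreal (diameter (B i j) powr l)) (prod_decode k))"
      by (auto simp: C_def split: prod.split intro!: suminf_cong)
    also have "\<dots> = (\<Sum>i. \<Sum>j. ennreal (diameter (B i j) powr l))"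
      by (intro suminf_ennreal_2dimen) auto
    finally show ?thesis .
  qed
  also have "\<dots> \<le> (\<Sum>i. hausdorff_content l (A i) + ennreal (e * (1/2)^Suc i))"
    using B(3) by (intro suminf_le) (auto simp: less_imp_le)
  also have "\<dots> = (\<Sum>i. hausdorff_content l (A i)) + (\<Sum>i. ennreal (e * (1/2)^Suc i))"
    by (intro suminf_add[symmetric]) auto
  also have "(\<Sum>i. ennreal (e * (1/2)^Suc i)) = ennreal e"
  proof (rule suminf_ennreal_eq)
    show "(\<lambda>i. e * (1/2)^Suc i) sums e"
      using sums_mult[OF power_half_series, of e] by simp
  qed (use \<open>0 < e\<close> in auto)
  finally show "hausdorff_content l (\<Union>i. A i) \<le> (\<Sum>i. hausdorff_content l (A i)) + ennreal e" .
qed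

lemma hausdorff_content_Un_le:
  "hausdorff_content l (A \<union> B) \<le> hausdorff_content l A + hausdorff_content l B"
proof -
  define C where "C i = (if i = 0 then A else if i = 1 then B else {})" for i :: nat
  have "A \<union> B = (\<Union>i. C i)" by (auto simp: C_def split: if_splits)
  moreover have "(\<Sum>i. hausdorff_content l (C i)) = (\<Sum>i\<in>{0,1}. hausdorff_content l (C i))"
    by (rule suminf_finite) (auto simp: C_def)
  ultimately show ?thesis
    using hausdorff_content_UN_le[of l C] by (simp add: C_def)
qed

lemma hausdorff_content_countable_cover:
  assumes "countable I" "A \<subseteq> (\<Union>i\<in>I. B i)" "\<And>i. i \<in> I \<Longrightarrow> bounded (B i)"
  shows "hausdorff_content l A \<le> (\<integral>\<^sup>+ i. ennreal (diameter (B i) powr l) \<partial>count_space I)"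
proof -
  define f where "f = to_nat_on I"
  have inj: "inj_on f I" unfolding f_def using assms(1) by (rule inj_on_to_nat_on)
  define X where "X j = (if j \<in> f ` I then B (inv_into I f j) else {})" for j
  have X_f: "X (f i) = B i" if "i \<in> I" for i
    using that inj by (simp add: X_def)
  have "A \<subseteq> (\<Union>j. X j)" using assms(2) X_f by fastforce
  moreover have "bounded (X j)" for j using assms(3) inj by (auto simp: X_def)
  ultimately have "hausdorff_content l A \<le> (\<Sum>j. ennreal (diameter (X j) powr l))"
    by (intro hausdorff_content_le) auto
  also have "\<dots> = (\<integral>\<^sup>+ j. ennreal (diameter (X j) powr l) \<partial>count_space UNIV)"
    by (simp add: nn_integral_count_space_nat)
  also have "\<dots> = (\<integral>\<^sup>+ j. ennreal (diameter (X j) powr l) * indicator (f ` I) j \<partial>count_space UNIV)"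
    by (intro nn_integral_cong) (auto simp: X_def)
  also have "\<dots> = (\<integral>\<^sup>+ j. ennreal (diameter (X j) powr l) \<partial>count_space (f ` I))"
    by (simp add: nn_integral_count_space_indicator)
  also have "\<dots> = (\<integral>\<^sup>+ i. ennreal (diameter (X (f i)) powr l) \<partial>count_space I)"
    using inj by (intro nn_integral_bij_count_space[symmetric]) (auto simp: bij_betw_def)
  also have "\<dots> = (\<integral>\<^sup>+ i. ennreal (diameter (B i) powr l) \<partial>count_space I)"
    by (intro nn_integral_cong) (auto simp: X_f)
  finally show ?thesis .
qed

text \<open>
  A cover of cost below \<open>1\<close> consists of sets of diameter at most \<open>1\<close>,
  for which a larger exponent gives a smaller cost. This makes smallness of the content for one
  exponent pass to all larger ones.
\<close>

lemma hausdorff_content_antimono_exponent: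
  assumes "0 < l" "l \<le> l'" "hausdorff_content l A < 1"
  shows "hausdorff_content l' A \<le> hausdorff_content l A"
proof (rule dense_ge_bounded[OF assms(3)])
  fix c :: ennreal assume "hausdorff_content l A < c" "c < 1"
  from this(1) obtain B where B: "A \<subseteq> (\<Union>j. B j)" "\<forall>j::nat. bounded (B j)"
    "(\<Sum>j. ennreal (diameter (B j) powr l)) < c"
    by (rule hausdorff_content_less_cover)
  have "diameter (B j) powr l' \<le> diameter (B j) powr l" for j
  proof -
    have "ennreal (diameter (B j) powr l) < 1"
      using ennreal_suminf_lessD[of "\<lambda>j. ennreal (diameter (B j) powr l)" 1 j] B(3) \<open>c < 1\<close> by auto
    then have "diameter (B j) powr l < 1 powr l"
      by simp
    then have "diameter (B j) \<le> 1"
      using assms(1) powr_mono2[of l 1 "diameter (B j)"] by fastforce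
    then show ?thesis
      using diameter_ge_0[OF B(2)[rule_format]] assms
      by (cases "diameter (B j) = 0") (auto intro!: powr_mono')
  qed
  then have "(\<Sum>j. ennreal (diameter (B j) powr l')) \<le> (\<Sum>j. ennreal (diameter (B j) powr l))"
    by (intro suminf_le) (auto intro: ennreal_leI)
  with B show "hausdorff_content l' A \<le> c"
    using hausdorff_content_le[OF B(1) B(2), of l'] by (meson le_less_trans less_imp_le order_trans)
qed

text \<open>
  A cover of \<open>E\<close> pulls back along \<open>f\<close> to a cover of \<open>A\<close>
  by sets of no larger diameter. This is the statement that 1-Lipschitz images have no larger
  content, written for a section of the Lipschitz map; it is applied to a choice of points of
  \<open>E\<close> above the points of its orthogonal projection.
\<close>

lemma hausdorff_content_le_of_expanding:
  assumes "\<And>x. x \<in> A \<Longrightarrow> f x \<in> E"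
    and "\<And>x y. x \<in> A \<Longrightarrow> y \<in> A \<Longrightarrow> dist x y \<le> dist (f x) (f y)"
    and "0 \<le> l"
  shows "hausdorff_content l A \<le> hausdorff_content l E"
proof (rule dense_ge)
  fix c assume "hausdorff_content l E < c"
  then obtain B where B: "E \<subseteq> (\<Union>j. B j)" "\<forall>j::nat. bounded (B j)"
    "(\<Sum>j. ennreal (diameter (B j) powr l)) < c"
    by (rule hausdorff_content_less_cover)
  define C where "C j = {x \<in> A. f x \<in> B j}" for j
  have dist_C: "dist x y \<le> diameter (B j)" if "x \<in> C j" "y \<in> C j" for x y j
    using that assms(2)[of x y] diameter_bounded_bound[OF B(2)[rule_format], of "f x" j "f y"] by (auto simp: C_def)
  have bdd: "bounded (C j)" for j
  proof (cases "C j = {}")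
    case False
    then obtain x where "x \<in> C j" by blast
    then show ?thesis unfolding bounded_def using dist_C by blast
  qed auto
  have diam: "diameter (C j) \<le> diameter (B j)" for j
    using dist_C diameter_ge_0[OF B(2)[rule_format]]
    by (cases "C j = {}") (auto simp: diameter_def[of "C j"] intro!: cSUP_least)
  have "A \<subseteq> (\<Union>j. C j)" using B(1) assms(1) by (fastforce simp: C_def)
  then have "hausdorff_content l A \<le> (\<Sum>j. ennreal (diameter (C j) powr l))"
    using bdd by (intro hausdorff_content_le) auto
  also have "\<dots> \<le> (\<Sum>j. ennreal (diameter (B j) powr l))"
    using diam diameter_ge_0[OF bdd] assms(3) by (intro suminf_le ennreal_leI powr_mono2) auto
  finally show "hausdorff_content l A \<le> c" using B(3) by simp
qed

text \<open>
  A cover of small total cost has only sets of small diameter, so the restriction on the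
  diameters in the Hausdorff measure is satisfied automatically.
\<close>

lemma hausdorff_measure_eq_0_of_content:
  assumes "0 < l" "hausdorff_content l A = 0"
  shows "hausdorff_measure l A = 0"
proof -
  have *: "(INF B\<in>{B :: nat \<Rightarrow> 'a set. A \<subseteq> (\<Union>j. B j) \<and> (\<forall>j. bounded (B j) \<and> diameter (B j) \<le> \<delta>)}.
      \<Sum>j. ennreal (diameter (B j) powr l)) \<le> ennreal e" (is "?I \<le> _") if "0 < \<delta>" "0 < e" for \<delta> e
  proof -
    have "hausdorff_content l A < ennreal (min e (\<delta> powr l))"
      using assms that by simp
    then obtain B where B: "A \<subseteq> (\<Union>j. B j)" "\<forall>j::nat. bounded (B j)"
      "(\<Sum>j. ennreal (diameter (B j) powr l)) < ennreal (min e (\<delta> powr l))"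
      by (rule hausdorff_content_less_cover)
    have "diameter (B j) \<le> \<delta>" for j
    proof -
      have "ennreal (diameter (B j) powr l) < ennreal (\<delta> powr l)"
        using ennreal_suminf_lessD[OF B(3), of j] by (simp add: ennreal_less_iff)
      then show ?thesis
        using assms(1) that powr_mono2[of l \<delta> "diameter (B j)"]
        by (auto simp: ennreal_less_iff) (meson less_imp_le not_le)
    qed
    then have "?I \<le> (\<Sum>j. ennreal (diameter (B j) powr l))"
      using B by (intro INF_lower) auto
    also have "\<dots> \<le> ennreal e" using B(3) by (meson ennreal_leI less_le_trans less_imp_le min.cobounded1)
    finally show ?thesis .
  qed
  show ?thesis
    unfolding hausdorff_measure_def
  proof (rule antisym[OF SUP_least])
    fix \<delta> :: real assume "\<delta> \<in> {0<..}"
    then have "0 < \<delta>" by simp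
    show "(INF B\<in>{B :: nat \<Rightarrow> 'a set. A \<subseteq> (\<Union>j. B j) \<and> (\<forall>j. bounded (B j) \<and> diameter (B j) \<le> \<delta>)}.
      \<Sum>j. ennreal (diameter (B j) powr l)) \<le> 0" (is "?I \<le> 0")
    proof (rule ennreal_le_epsilon)
      fix e :: real assume "0 < e"
      from *[OF \<open>0 < \<delta>\<close> this] show "?I \<le> 0 + ennreal e" by simp
    qed
  qed auto
qed

text \<open>
  A bounded set lies in a closed ball whose radius is the diameter of the set, so a cover of
  finite cost bounds the Lebesgue measure.
\<close>

lemma hausdorff_content_eq_top:
  fixes A :: "'a::euclidean_space set"
  assumes "emeasure lborel A = top"
  shows "hausdorff_content (real DIM('a)) A = top"
proof (rule ccontr)
  let ?v = "unit_ball_vol (real DIM('a))"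
  have vol: "\<exists>c. X \<subseteq> cball c (diameter X) \<and>
      emeasure lborel (cball c (diameter X)) = ennreal ?v * ennreal (diameter X powr real DIM('a))"
    if "bounded X" for X :: "'a set"
  proof -
    have "\<exists>c. X \<subseteq> cball c (diameter X)"
      using diameter_bounded_bound[OF that] by (meson equals0I mem_cball subsetI)
    then obtain c where "X \<subseteq> cball c (diameter X)" ..
    moreover have "diameter X powr real DIM('a) = diameter X ^ DIM('a)"
      using diameter_ge_0[OF \<open>bounded X\<close>] by (cases "diameter X = 0") (auto simp: powr_realpow)
    ultimately show ?thesis
      using diameter_ge_0[OF \<open>bounded X\<close>] by (auto simp: emeasure_cball ennreal_mult' intro!: exI[of _ c])
  qed
  assume "hausdorff_content (real DIM('a)) A \<noteq> top"
  then have "hausdorff_content (real DIM('a)) A < top"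
    by (simp add: less_top)
  then obtain B where B: "A \<subseteq> (\<Union>j. B j)" "\<forall>j::nat. bounded (B j)"
    "(\<Sum>j. ennreal (diameter (B j) powr real DIM('a))) < top"
    by (rule hausdorff_content_less_cover)
  have "\<forall>j. \<exists>c. B j \<subseteq> cball c (diameter (B j)) \<and>
      emeasure lborel (cball c (diameter (B j))) = ennreal ?v * ennreal (diameter (B j) powr real DIM('a))"
    using vol B(2) by blast
  then obtain c where c: "\<And>j. B j \<subseteq> cball (c j) (diameter (B j))"
    "\<And>j. emeasure lborel (cball (c j) (diameter (B j))) =
      ennreal ?v * ennreal (diameter (B j) powr real DIM('a))"
    by metis
  have "emeasure lborel A \<le> emeasure lborel (\<Union>j. cball (c j) (diameter (B j)))"
    using c(1) by (intro emeasure_mono subset_trans[OF B(1)] UN_mono) auto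
  also have "\<dots> \<le> (\<Sum>j. emeasure lborel (cball (c j) (diameter (B j))))"
    by (intro emeasure_subadditive_countably) auto
  also have "\<dots> = ennreal ?v * (\<Sum>j. ennreal (diameter (B j) powr real DIM('a)))"
    by (simp add: c(2))
  finally show False
    using B(3) assms by (auto simp: top_unique ennreal_mult_eq_top_iff)
qed

lemma hausdorff_content_outside_ball:
  "hausdorff_content (real DIM('a)) (- ball (0::'a::euclidean_space) r) = top"
proof -
  have "emeasure lborel (UNIV::'a set) \<le> emeasure lborel (ball (0::'a) r) + emeasure lborel (- ball (0::'a) r)"
    using emeasure_subadditive[of "ball (0::'a) r" lborel "- ball 0 r"] by simp
  then have "emeasure lborel (- ball (0::'a) r) = top"
    using emeasure_lborel_ball_finite[of "0::'a" r]
    by (auto simp: emeasure_lborel_UNIV top_unique less_top)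
  then show ?thesis by (rule hausdorff_content_eq_top)
qed

section \<open>Points where a finite measure has large density\<close>

lemma tendsto_measure_outside_ball:
  fixes M :: "'a::real_normed_vector measure"
  assumes "finite_measure M" and [simp]: "sets M = sets borel"
  shows "(\<lambda>m. measure M (- ball (0::'a) (real m))) \<longlonglongrightarrow> 0"
proof -
  interpret finite_measure M by fact
  have "(\<lambda>m. measure M (- ball (0::'a) (real m))) \<longlonglongrightarrow> measure M (\<Inter>m. - ball (0::'a) (real m))"
    by (intro finite_Lim_measure_decseq) (auto simp: decseq_def)
  moreover have "(\<Inter>m. - ball (0::'a) (real m)) = {}"
  proof -
    have "x \<notin> (\<Inter>m. - ball (0::'a) (real m))" for x
    proof -
      obtain m where "norm x < real m" using reals_Archimedean2 by blast
      then show ?thesis by auto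
    qed
    then show ?thesis by blast
  qed
  ultimately show ?thesis by simp
qed

text \<open>
  The radii are at most \<open>1\<close>, so Vitali's lemma selects disjoint balls
  \<open>B(x,r)\<close> whose dilates by \<open>5\<close> cover the set. The costs \<open>(10
  r)\<^sup>l\<close> of the dilates are controlled by the measures of the disjoint balls, all of
  which lie outside the ball of radius \<open>m - 1\<close>.
\<close>

lemma hausdorff_content_large_ball_measure:
  fixes \<mu> :: "'a::euclidean_space measure"
  assumes "finite_measure \<mu>" and [simp]: "sets \<mu> = sets borel" and "0 < \<eta>" "0 < l"
  shows "hausdorff_content l
      {x. m \<le> norm x \<and> (\<exists>r. 0 < r \<and> r \<le> 1 \<and> \<eta> * r powr l < measure \<mu> (ball x r))} \<le>
    ennreal (10 powr l / \<eta> * measure \<mu> (- ball 0 (m - 1)))"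
proof -
  interpret finite_measure \<mu> by fact
  define S where "S = {x. m \<le> norm x \<and> (\<exists>r. 0 < r \<and> r \<le> 1 \<and> \<eta> * r powr l < measure \<mu> (ball x r))}"
  have "\<forall>x\<in>S. \<exists>r. 0 < r \<and> r \<le> 1 \<and> \<eta> * r powr l < measure \<mu> (ball x r)" by (auto simp: S_def)
  then obtain r where r: "\<And>x. x \<in> S \<Longrightarrow> 0 < r x" "\<And>x. x \<in> S \<Longrightarrow> r x \<le> 1"
    "\<And>x. x \<in> S \<Longrightarrow> \<eta> * r x powr l < measure \<mu> (ball x (r x))"
    by metis
  have "S \<subseteq> (\<Union>i\<in>S. ball i (r i))"
    using r(1) by (auto intro: centre_in_ball[THEN iffD2])
  then obtain I where I: "countable I" "I \<subseteq> S"
    "pairwise (\<lambda>i j. disjnt (ball i (r i)) (ball j (r j))) I" "S \<subseteq> (\<Union>i\<in>I. ball i (5 * r i))"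
  proof (rule Vitali_covering_lemma_balls[where B = 1])
    show "0 < r i \<and> r i \<le> 1" if "i \<in> S" for i using r(1,2)[OF that] by simp
  qed
  have "hausdorff_content l S \<le> (\<integral>\<^sup>+ i. ennreal (diameter (ball i (5 * r i)) powr l) \<partial>count_space I)"
    using I by (intro hausdorff_content_countable_cover) auto
  also have "\<dots> \<le> (\<integral>\<^sup>+ i. ennreal (10 powr l / \<eta>) * emeasure \<mu> (ball i (r i)) \<partial>count_space I)"
  proof (rule nn_integral_mono)
    fix i assume "i \<in> space (count_space I)"
    then have "i \<in> S" using I by auto
    have "diameter (ball i (5 * r i)) powr l = 10 powr l * r i powr l"
      using r(1)[OF \<open>i \<in> S\<close>] by (simp add: powr_mult[symmetric])
    also have "\<dots> = 10 powr l / \<eta> * (\<eta> * r i powr l)" using \<open>0 < \<eta>\<close> by simp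
    also have "\<dots> \<le> 10 powr l / \<eta> * measure \<mu> (ball i (r i))"
      using r(3)[OF \<open>i \<in> S\<close>] \<open>0 < \<eta>\<close> by (intro mult_left_mono) auto
    finally show "ennreal (diameter (ball i (5 * r i)) powr l) \<le>
        ennreal (10 powr l / \<eta>) * emeasure \<mu> (ball i (r i))"
      using \<open>0 < \<eta>\<close> by (simp add: emeasure_eq_measure ennreal_mult[symmetric] ennreal_leI)
  qed
  also have "\<dots> = ennreal (10 powr l / \<eta>) * emeasure \<mu> (\<Union>i\<in>I. ball i (r i))"
    using I by (subst emeasure_UN_countable)
      (auto simp: nn_integral_cmult disjoint_family_on_def pairwise_def disjnt_def)
  also have "\<dots> \<le> ennreal (10 powr l / \<eta>) * emeasure \<mu> (- ball 0 (m - 1))"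
  proof (intro mult_left_mono emeasure_mono)
    show "(\<Union>i\<in>I. ball i (r i)) \<subseteq> - ball 0 (m - 1)"
    proof clarsimp
      fix i y assume "i \<in> I" "dist i y < r i" "norm y < m - 1"
      then show False
        using I(2) r(2)[of i] norm_triangle_ineq2[of i y] by (auto simp: S_def dist_norm)
    qed
  qed auto
  also have "\<dots> = ennreal (10 powr l / \<eta> * measure \<mu> (- ball 0 (m - 1)))"
    using \<open>0 < \<eta>\<close> by (simp add: emeasure_eq_measure ennreal_mult[symmetric])
  finally show ?thesis by (simp add: S_def)
qed

section \<open>Exceptional sets that are thin at infinity\<close>

lemma tendsto_zero_ennrealI:
  fixes f :: "nat \<Rightarrow> ennreal"
  assumes "\<And>e. 0 < e \<Longrightarrow> eventually (\<lambda>m. f m < ennreal e) sequentially"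
  shows "f \<longlonglongrightarrow> 0"
proof (rule order_tendstoI)
  fix a :: ennreal assume "0 < a"
  then obtain b where "0 < b" "b < a" using dense by blast
  then obtain e where "b = ennreal e" "0 < e"
    by (cases b) auto
  with assms[of e] \<open>b < a\<close> show "eventually (\<lambda>m. f m < a) sequentially"
    by (auto elim!: eventually_mono)
qed auto

text \<open>
  The diagonal argument: the hypothesis gives, for each exponent \<open>l\<close> and each
  tolerance \<open>e\<close> separately, that the set where \<open>f\<close> is not
  \<open>e\<close>-close to \<open>K\<close> has small \<open>l\<close>-content near infinity;
  the conclusion is one set that serves for all exponents and all tolerances. The set is the
  union over \<open>i\<close> of the deviation set with tolerance \<open>1/(i+1)\<close>, cut
  off at a radius where its content with exponent \<open>d + 1/(i+1)\<close> is below
  \<open>2\<^bsup>-(i+1)\<^esup>\<close>. For a given \<open>l\<close> all but finitely many of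
  these exponents are below \<open>l\<close>, and the finitely many remaining deviation sets lie
  in a single one, to which the hypothesis applies with the exponent \<open>l\<close> itself.
\<close>

lemma ex_thin_exceptional_set:
  fixes f :: "real ^ 'n \<Rightarrow> ereal"
  assumes "0 \<le> d"
    and dev: "\<And>l e. d < l \<Longrightarrow> 0 < e \<Longrightarrow>
      (\<lambda>m::nat. hausdorff_content l ({x. \<not> \<bar>f x - ereal K\<bar> < ereal e} \<inter> - ball 0 (real m))) \<longlonglongrightarrow> 0"
  shows "\<exists>E. (\<forall>l>d. (\<lambda>m::nat. hausdorff_content l (E \<inter> - ball 0 (real m))) \<longlonglongrightarrow> 0) \<and>
    has_limit_outside f E K"
proof -
  define D where "D i = {x. \<not> \<bar>f x - ereal K\<bar> < ereal (1 / real (Suc i))}" for i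
  define L where "L i = d + 1 / real (Suc i)" for i
  have D_mono: "D i \<subseteq> D j" if "i \<le> j" for i j
  proof -
    have "ereal (1 / real (Suc j)) \<le> ereal (1 / real (Suc i))" using that by (simp add: frac_le)
    then show ?thesis unfolding D_def using less_le_trans by blast
  qed
  have "\<exists>m::nat. hausdorff_content (L i) (D i \<inter> - ball 0 (real m)) < ennreal ((1/2) ^ Suc i)" for i
  proof -
    have "(\<lambda>m::nat. hausdorff_content (L i) (D i \<inter> - ball 0 (real m))) \<longlonglongrightarrow> 0"
      unfolding D_def by (rule dev) (auto simp: L_def)
    then have "eventually (\<lambda>m::nat. hausdorff_content (L i) (D i \<inter> - ball 0 (real m)) < ennreal ((1/2) ^ Suc i)) sequentially"
      by (rule order_tendstoD) simp
    then show ?thesis by (rule eventually_happens'[OF sequentially_bot])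
  qed
  then obtain m where m: "\<And>i. hausdorff_content (L i) (D i \<inter> - ball 0 (real (m i))) < ennreal ((1/2) ^ Suc i)"
    by metis
  define A where "A i = D i \<inter> - ball 0 (real (m i))" for i
  have "(\<lambda>k::nat. hausdorff_content l ((\<Union>i. A i) \<inter> - ball 0 (real k))) \<longlonglongrightarrow> 0" if "d < l" for l
  proof (rule tendsto_zero_ennrealI)
    fix e :: real assume "0 < e"
    \<comment> \<open>From index \<open>N1\<close> on, the exponents are below \<open>l\<close>; from \<open>N2\<close> on, the tail of the geometric series is below \<open>e / 2\<close>.\<close>
    obtain N1 where N1: "1 / real (Suc N1) < l - d"
      using reals_Archimedean[of "l - d"] \<open>d < l\<close> by (auto simp: inverse_eq_divide)
    obtain N2 where N2: "(1/2) ^ N2 < e / 2"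
      using real_arch_pow_inv[of "e / 2" "1/2"] \<open>0 < e\<close> by auto
    define N where "N = max N1 N2"
    have N: "1 / real (Suc i) < l - d" if "N \<le> i" for i
      using that by (intro le_less_trans[OF _ N1] frac_le) (auto simp: N_def)
    have "(1/2::real) ^ N \<le> (1/2) ^ N2" by (intro power_decreasing) (auto simp: N_def)
    from this N2 have N': "(1/2) ^ N < e / 2" by (rule le_less_trans)
    have tail: "hausdorff_content l (\<Union>i. A (i + N)) \<le> ennreal ((1/2) ^ N)"
    proof -
      have "hausdorff_content l (A (i + N)) \<le> ennreal ((1/2) ^ N * (1/2) ^ Suc i)" for i
      proof -
        have "ennreal ((1/2) ^ Suc (i + N)) \<le> 1"
          unfolding ennreal_le_1 by (intro power_le_one) auto
        with m[of "i + N"] have "hausdorff_content (L (i + N)) (A (i + N)) < 1"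
          unfolding A_def by (rule less_le_trans)
        then have "hausdorff_content l (A (i + N)) \<le> hausdorff_content (L (i + N)) (A (i + N))"
          using N[of "i + N"] \<open>0 \<le> d\<close>
          by (intro hausdorff_content_antimono_exponent) (auto simp: L_def intro: add_nonneg_pos)
        also have "\<dots> \<le> ennreal ((1/2) ^ Suc (i + N))" using m[of "i + N"] by (simp add: A_def)
        also have "\<dots> = ennreal ((1/2) ^ N * (1/2) ^ Suc i)" by (simp add: power_add mult_ac)
        finally show ?thesis .
      qed
      then have "(\<Sum>i. hausdorff_content l (A (i + N))) \<le> (\<Sum>i. ennreal ((1/2) ^ N * (1/2) ^ Suc i))"
        by (intro suminf_le) auto
      also have "\<dots> = ennreal ((1/2) ^ N)"
        using sums_mult[OF power_half_series, of "(1/2) ^ N"] by (intro suminf_ennreal_eq) auto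
      finally show ?thesis using hausdorff_content_UN_le[of l "\<lambda>i. A (i + N)"] by (rule order_trans[rotated])
    qed
    have "(\<lambda>k::nat. hausdorff_content l (D N \<inter> - ball 0 (real k))) \<longlonglongrightarrow> 0"
      unfolding D_def using \<open>d < l\<close> by (intro dev) auto
    then have "eventually (\<lambda>k::nat. hausdorff_content l (D N \<inter> - ball 0 (real k)) < ennreal (e / 2)) sequentially"
      by (rule order_tendstoD) (use \<open>0 < e\<close> in auto)
    then show "eventually (\<lambda>k::nat. hausdorff_content l ((\<Union>i. A i) \<inter> - ball 0 (real k)) < ennreal e) sequentially"
    proof eventually_elim
      case (elim k)
      have "(\<Union>i. A i) \<inter> - ball 0 (real k) \<subseteq> (D N \<inter> - ball 0 (real k)) \<union> (\<Union>i. A (i + N))"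
      proof clarsimp
        fix x i assume "x \<in> A i" "\<forall>i. x \<notin> A (i + N)" "\<not> norm x < real k"
        then have "i < N" by (metis le_add_diff_inverse2 not_le)
        then show "x \<in> D N" using \<open>x \<in> A i\<close> D_mono[of i N] by (auto simp: A_def)
      qed
      then have "hausdorff_content l ((\<Union>i. A i) \<inter> - ball 0 (real k)) \<le>
          hausdorff_content l (D N \<inter> - ball 0 (real k)) + hausdorff_content l (\<Union>i. A (i + N))"
        by (rule order_trans[OF hausdorff_content_mono hausdorff_content_Un_le])
      also have "\<dots> < ennreal (e / 2) + ennreal (e / 2)"
        using elim tail N' \<open>0 < e\<close> by (intro add_strict_mono) (auto simp: ennreal_less_iff intro: le_less_trans)
      also have "\<dots> = ennreal e" using \<open>0 < e\<close> by (simp flip: ennreal_plus)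
      finally show ?case .
    qed
  qed
  moreover have "has_limit_outside f (\<Union>i. A i) K"
    unfolding has_limit_outside_def
  proof (intro allI impI)
    fix e :: real assume "0 < e"
    then obtain i where i: "1 / real (Suc i) < e"
      using reals_Archimedean[of e] by (auto simp: inverse_eq_divide)
    have "\<bar>f x - ereal K\<bar> < ereal e" if "x \<notin> (\<Union>i. A i)" "norm x > max 1 (real (m i))" for x
    proof -
      have "x \<notin> D i" using that by (auto simp: A_def)
      then have "\<bar>f x - ereal K\<bar> < ereal (1 / real (Suc i))" by (simp add: D_def)
      also have "\<dots> < ereal e" using i by simp
      finally show ?thesis .
    qed
    then show "\<exists>R>0. \<forall>x. x \<notin> (\<Union>i. A i) \<and> R < norm x \<longrightarrow> \<bar>f x - ereal K\<bar> < ereal e"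
      by (intro exI[of _ "max 1 (real (m i))"]) auto
  qed
  ultimately show ?thesis by blast
qed

section \<open>Medians, cubes and the precise representative\<close>

text \<open>
  If \<open>u\<close> is within \<open>t\<close> of \<open>a\<close> on more than half of
  \<open>E\<close>, then the level \<open>a - t\<close> is admissible in the supremum that
  defines the median, while no level above \<open>a + t\<close> is.
\<close>

lemma median_close:
  fixes u :: "real ^ 'n \<Rightarrow> real"
  assumes u [measurable]: "u \<in> borel_measurable lebesgue" and E: "E \<in> lmeasurable"
    and small: "measure lebesgue {y \<in> E. t < \<bar>u y - a\<bar>} < measure lebesgue E / 2"
  shows "\<bar>median u E - a\<bar> \<le> t"
proof -
  have [measurable]: "E \<in> sets lebesgue" using E by auto
  have lm: "{y \<in> E. P y} \<in> lmeasurable" if "Measurable.pred lebesgue P" for P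
  proof (rule fmeasurableI2[OF E])
    show "{y \<in> E. P y} \<in> sets lebesgue" using that by measurable
  qed auto
  define S where "S = {M. measure lebesgue {x \<in> E. u x < M} \<le> measure lebesgue E / 2}"
  have "measure lebesgue {x \<in> E. u x < a - t} \<le> measure lebesgue {y \<in> E. t < \<bar>u y - a\<bar>}"
    by (intro measure_mono_fmeasurable lm fmeasurableD) auto
  then have low: "a - t \<in> S" using small by (simp add: S_def)
  have up: "M \<le> a + t" if "M \<in> S" for M
  proof (rule ccontr)
    assume "\<not> M \<le> a + t"
    then have "E \<subseteq> {x \<in> E. u x < M} \<union> {y \<in> E. t < \<bar>u y - a\<bar>}" by auto
    then have "measure lebesgue E \<le> measure lebesgue ({x \<in> E. u x < M} \<union> {y \<in> E. t < \<bar>u y - a\<bar>})"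
      by (intro measure_mono_fmeasurable fmeasurable.Un lm) auto
    also have "\<dots> \<le> measure lebesgue {x \<in> E. u x < M} + measure lebesgue {y \<in> E. t < \<bar>u y - a\<bar>}"
      by (intro measure_Un_le) (auto intro!: fmeasurableD lm)
    also have "\<dots> < measure lebesgue E"
      using that small by (auto simp: S_def)
    finally show False by simp
  qed
  have "Sup S \<le> a + t" using low up by (intro cSup_least) auto
  moreover have "a - t \<le> Sup S" using low up by (intro cSup_upper) (auto intro!: bdd_aboveI)
  ultimately show ?thesis by (simp add: median_def S_def abs_le_iff)
qed

lemma median_cong_AE:
  assumes u: "u \<in> borel_measurable lebesgue" and v: "v \<in> borel_measurable lebesgue"
    and "AE x in lebesgue. u x = v x" and "E \<in> sets lebesgue"
  shows "median u E = median v E"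
proof -
  have "measure lebesgue {x \<in> E. u x < M} = measure lebesgue {x \<in> E. v x < M}" for M
  proof (rule measure_eq_AE)
    show "AE x in lebesgue. (x \<in> {x \<in> E. u x < M}) = (x \<in> {x \<in> E. v x < M})"
      using assms(3) by eventually_elim auto
    show "{x \<in> E. u x < M} \<in> sets lebesgue" "{x \<in> E. v x < M} \<in> sets lebesgue"
      using assms(4) u v by measurable
  qed
  then show ?thesis by (simp add: median_def)
qed

text \<open>
  A cube seen from any of its points: its volume is comparable to that of a ball around the
  point that contains it. The factor \<open>2\<close> leaves room for an open ball.
\<close>

lemma half_open_cubeE:
  fixes Q :: "(real ^ 'n) set"
  assumes "half_open_cube Q"
  obtains l where "0 < l" "Q \<in> sets borel" "measure lborel Q = l ^ CARD('n)"
    "\<And>x. x \<in> Q \<Longrightarrow> Q \<subseteq> ball x (2 * real CARD('n) * l)"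
proof -
  obtain a b l where l: "0 < l" "\<And>i. b $ i - a $ i = l"
    and Q: "Q = {x. \<forall>i. a $ i \<le> x $ i \<and> x $ i < b $ i}"
    using assms unfolding half_open_cube_def by auto
  have "Q = (\<Inter>i. {x. a $ i \<le> x $ i} \<inter> {x. x $ i < b $ i})" by (auto simp: Q)
  moreover have "(\<Inter>i. {x. a $ i \<le> x $ i} \<inter> {x. x $ i < b $ i}) \<in> sets borel"
    by (intro sets.finite_INT sets.Int borel_closed borel_open closed_halfspace_component_ge_cart
        open_halfspace_component_lt_cart) auto
  ultimately have Qb: "Q \<in> sets borel" by simp
  have "box a b \<subseteq> Q" "Q \<subseteq> cbox a b" by (auto simp: Q mem_box_cart less_imp_le)
  moreover have cb: "measure lborel (cbox a b) = l ^ CARD('n)"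
    using l by (subst content_cbox_cart) (auto simp: cbox_interval[symmetric] interval_ne_empty_cart algebra_simps less_imp_le)
  moreover have "measure lborel (box a b) = measure lborel (cbox a b)"
    by (simp add: measure_lborel_box_eq measure_lborel_cbox_eq)
  ultimately have m: "measure lborel Q = l ^ CARD('n)"
    using Qb measure_mono_fmeasurable[of "box a b" Q lborel] measure_mono_fmeasurable[of Q "cbox a b" lborel]
      fmeasurableI2[of "cbox a b" lborel Q]
    by force
  have "Q \<subseteq> ball x (2 * real CARD('n) * l)" if "x \<in> Q" for x
  proof
    fix y assume "y \<in> Q"
    have "\<bar>(x - y) $ i\<bar> \<le> l" for i
      using l(2)[of i] \<open>x \<in> Q\<close> \<open>y \<in> Q\<close> by (auto simp: Q abs_le_iff) (smt (verit))+
    then have "norm (x - y) \<le> real CARD('n) * l"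
      using norm_le_l1_cart[of "x - y"] sum_bounded_above[of UNIV "\<lambda>i. \<bar>(x - y) $ i\<bar>" l] by force
    then show "y \<in> ball x (2 * real CARD('n) * l)"
      using l(1) zero_less_card_finite[where 'a='n] by (auto simp: dist_norm intro: le_less_trans)
  qed
  with l(1) Qb m show thesis by (rule that)
qed

lemma ex_small_half_open_cube:
  assumes "0 < e"
  shows "\<exists>Q. half_open_cube Q \<and> (x :: real ^ 'n) \<in> Q \<and> measure lebesgue Q < e"
proof -
  define l where "l = min 1 (e / 2)"
  have l: "0 < l" "l \<le> 1" "l < e" using assms by (auto simp: l_def)
  define Q where "Q = {y. \<forall>i. x $ i \<le> y $ i \<and> y $ i < (\<chi> i. x $ i + l) $ i}"
  have Q: "half_open_cube Q"
    unfolding half_open_cube_def Q_def using l by (intro exI[of _ x] exI[of _ "\<chi> i. x $ i + l"]) auto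
  have "Q \<subseteq> cbox x (\<chi> i. x $ i + l)" by (auto simp: Q_def mem_box_cart less_imp_le)
  moreover have "measure lborel (cbox x (\<chi> i. x $ i + l)) = l ^ CARD('n)"
    using l by (subst content_cbox_cart) (auto simp: cbox_interval[symmetric] interval_ne_empty_cart algebra_simps less_imp_le)
  moreover have Qb: "Q \<in> sets borel" using half_open_cubeE[OF Q] by metis
  ultimately have "measure lebesgue Q \<le> l ^ CARD('n)"
    using measure_mono_fmeasurable[of Q "cbox x (\<chi> i. x $ i + l)" lborel] by simp
  also have "\<dots> \<le> l ^ 1" using l by (intro power_decreasing) auto
  finally show ?thesis using Q l by (intro exI[of _ Q]) (auto simp: Q_def)
qed

text \<open>
  Arbitrarily small cubes contain \<open>x\<close>, so the suprema in the definition of the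
  precise representative range over nonempty families and a two-sided bound on the medians
  passes to the limit superior.
\<close>

lemma precise_rep_close:
  fixes u :: "real ^ 'n \<Rightarrow> real"
  assumes "0 < e"
    and "\<And>Q. half_open_cube Q \<Longrightarrow> x \<in> Q \<Longrightarrow> measure lebesgue Q < e \<Longrightarrow> \<bar>median u Q - a\<bar> \<le> t"
  shows "\<bar>precise_rep u x - ereal a\<bar> \<le> ereal t"
proof -
  have "precise_rep u x \<le> (SUP Q\<in>{Q. half_open_cube Q \<and> x \<in> Q \<and> measure lebesgue Q < e}. ereal (median u Q))"
    unfolding precise_rep_def using \<open>0 < e\<close> by (intro INF_lower) auto
  also have "\<dots> \<le> ereal (a + t)"
  proof (rule SUP_least)
    fix Q assume "Q \<in> {Q. half_open_cube Q \<and> x \<in> Q \<and> measure lebesgue Q < e}"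
    then show "ereal (median u Q) \<le> ereal (a + t)" using assms(2)[of Q] by (auto simp: abs_le_iff)
  qed
  finally have up: "precise_rep u x \<le> ereal (a + t)" .
  have low: "ereal (a - t) \<le> precise_rep u x"
    unfolding precise_rep_def
  proof (rule INF_greatest)
    fix \<delta> :: real assume "\<delta> \<in> {0<..}"
    then obtain Q where Q: "half_open_cube Q" "x \<in> Q" "measure lebesgue Q < min \<delta> e"
      using ex_small_half_open_cube[of "min \<delta> e" x] \<open>0 < e\<close> by auto
    then have "ereal (a - t) \<le> ereal (median u Q)" using assms(2)[of Q] by (auto simp: abs_le_iff)
    also have "\<dots> \<le> (SUP Q\<in>{Q. half_open_cube Q \<and> x \<in> Q \<and> measure lebesgue Q < \<delta>}. ereal (median u Q))"
      using Q by (intro SUP_upper) auto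
    finally show "ereal (a - t) \<le> \<dots>" .
  qed
  from up low show ?thesis
    by (cases "precise_rep u x") (auto simp: abs_le_iff)
qed

section \<open>Oscillation of medians under a finite seminorm\<close>

text \<open>
  The inner integral of the seminorm, with respect to Borel--Lebesgue measure, so that for Borel
  \<open>u\<close> it is a Borel function of \<open>x\<close>.
\<close>

definition frac_energy :: "real \<Rightarrow> real \<Rightarrow> (real ^ 'n \<Rightarrow> real) \<Rightarrow> real ^ 'n \<Rightarrow> ennreal" where
  "frac_energy s q u x =
     (\<integral>\<^sup>+ y. ennreal (\<bar>u x - u y\<bar> powr q / norm (x - y) powr (real CARD('n) + s * q)) \<partial>lborel)"

text \<open>
  Chebyshev's inequality: where \<open>\<bar>u z - u y\<bar> > t\<close> and \<open>y \<in>
  E\<close>, the integrand of the energy at \<open>z\<close> is at least \<open>t\<^sup>q /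
  D\<^bsup>n+sq\<^esup>\<close>. The assumption on \<open>\<gamma>\<close> says that this can
  happen on less than half of \<open>E\<close>.
\<close>

lemma median_close_of_frac_energy:
  fixes u :: "real ^ 'n \<Rightarrow> real"
  assumes u [measurable]: "u \<in> borel_measurable borel" and "0 < q" "0 < s" "0 < t" "0 < D"
    and E [measurable]: "E \<in> sets borel" and ED: "E \<subseteq> cball z D" and pos: "0 < measure lborel E"
    and energy: "frac_energy s q u z < ennreal \<gamma>"
    and \<gamma>: "\<gamma> * D powr (real CARD('n) + s * q) \<le> t powr q * (measure lborel E / 2)"
  shows "\<bar>median u E - u z\<bar> \<le> t"
proof (rule median_close)
  define a where "a = real CARD('n) + s * q"
  define A where "A = {y \<in> E. t < \<bar>u y - u z\<bar>}"
  have [measurable]: "A \<in> sets borel" unfolding A_def by measurable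
  have Elm: "E \<in> fmeasurable lborel"
    using E ED by (intro fmeasurableI2[OF fmeasurable_compact[OF compact_cball] ED]) simp
  then have Alm: "A \<in> fmeasurable lborel"
    by (rule fmeasurableI2) (auto simp: A_def)
  show "u \<in> borel_measurable lebesgue" using u by (intro measurable_completion) simp
  show "E \<in> lmeasurable" using Elm by (auto simp: fmeasurable_def)
  have "0 < \<gamma>" using energy by (cases "0 < \<gamma>") (auto simp: ennreal_neg)
  define c where "c = t powr q / D powr a"
  have "0 < c" using \<open>0 < t\<close> \<open>0 < D\<close> by (simp add: c_def)
  have "ennreal c * emeasure lborel A = (\<integral>\<^sup>+ y. ennreal c * indicator A y \<partial>lborel)"
    by (simp add: nn_integral_cmult_indicator)
  also have "\<dots> \<le> frac_energy s q u z"
    unfolding frac_energy_def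
  proof (rule nn_integral_mono)
    fix y
    show "ennreal c * indicator A y \<le>
        ennreal (\<bar>u z - u y\<bar> powr q / norm (z - y) powr (real CARD('n) + s * q))"
    proof (cases "y \<in> A")
      case True
      then have "y \<noteq> z" "t \<le> \<bar>u z - u y\<bar>" using \<open>0 < t\<close> by (auto simp: A_def)
      moreover have "norm (z - y) \<le> D" using True ED by (auto simp: A_def dist_norm)
      ultimately have "c \<le> \<bar>u z - u y\<bar> powr q / norm (z - y) powr a"
        using \<open>0 < t\<close> \<open>0 < q\<close> \<open>0 < s\<close> unfolding c_def
        by (intro frac_le powr_mono2) (auto simp: a_def)
      then show ?thesis using True by (auto simp: a_def intro: ennreal_leI)
    qed auto
  qed
  also have "\<dots> < ennreal \<gamma>" by (rule energy)
  finally have "ennreal (c * measure lborel A) < ennreal \<gamma>"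
    using Alm \<open>0 < c\<close> by (simp add: emeasure_eq_measure2 ennreal_mult)
  then have "c * measure lborel A < \<gamma>" using \<open>0 < c\<close> by (simp add: ennreal_less_iff)
  also have "\<gamma> \<le> c * (measure lborel E / 2)"
    using \<gamma> \<open>0 < D\<close> by (simp add: c_def a_def field_simps)
  finally show "measure lebesgue {y \<in> E. t < \<bar>u y - u z\<bar>} < measure lebesgue E / 2"
    using \<open>0 < c\<close> by (simp add: A_def)
qed

text \<open>
  The density of a measure cannot exceed its mean value at every point of a set.
\<close>

lemma ex_less_of_density_less:
  fixes g :: "real ^ 'n \<Rightarrow> ennreal"
  assumes [measurable]: "g \<in> borel_measurable borel" "B \<in> sets borel"
    and less: "emeasure (density lborel g) B < ennreal h * emeasure lborel B"
  shows "\<exists>z\<in>B. g z < ennreal h"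
proof (rule ccontr)
  assume "\<not> ?thesis"
  then have "(\<integral>\<^sup>+ x. ennreal h * indicator B x \<partial>lborel) \<le> (\<integral>\<^sup>+ x. g x * indicator B x \<partial>lborel)"
    by (intro nn_integral_mono) (auto simp: not_less split: split_indicator)
  then show False
    using less by (simp add: emeasure_density nn_integral_cmult_indicator)
qed

lemma ennpowr_less_imp:
  assumes "ennpowr x a < ennreal h" "0 < a"
  shows "x < ennreal (h powr (1 / a))"
proof -
  from assms have "x \<noteq> top" by (auto simp: ennpowr_def)
  then obtain c where c: "0 \<le> c" "x = ennreal c" by (cases x) auto
  with assms have "c powr a < h" by (auto simp: ennpowr_def ennreal_less_iff split: if_splits)
  then have "(c powr a) powr (1 / a) < h powr (1 / a)"
    using assms(2) by (intro powr_less_mono2) auto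
  then show ?thesis using c assms(2) by (simp add: powr_powr ennreal_less_iff)
qed

text \<open>
  The \<open>p\<close>-th power of the seminorm is the total mass of this measure.
\<close>

definition energy_measure ::
    "real \<Rightarrow> real \<Rightarrow> real \<Rightarrow> (real ^ 'n \<Rightarrow> real) \<Rightarrow> (real ^ 'n) measure" where
  "energy_measure s p q u = density lborel (\<lambda>x. ennpowr (frac_energy s q u x) (p / q))"

lemma measurable_ennpowr [measurable]: "(\<lambda>x. ennpowr x a) \<in> borel_measurable borel"
  unfolding ennpowr_def by measurable

lemma measurable_frac_energy [measurable]:
  assumes [measurable]: "u \<in> borel_measurable borel"
  shows "frac_energy s q u \<in> borel_measurable borel"
  unfolding frac_energy_def by measurable

text \<open>
  Both medians are compared with \<open>u z\<close>, where \<open>z\<close> is a point of the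
  ball at which the density of the energy measure is below a prescribed number that exceeds its
  mean. This gives the bound with every \<open>t\<close> above the critical value, and
  \<open>t\<close> then decreases to it; strict inequalities throughout also cover balls of
  measure zero, where the critical value is \<open>0\<close>.
\<close>

lemma median_oscillation_le:
  fixes u :: "real ^ 'n \<Rightarrow> real"
  assumes u [measurable]: "u \<in> borel_measurable borel" and pos: "0 < s" "0 < p" "0 < q" "0 < \<tau>"
    and fin: "finite_measure (energy_measure s p q u)"
  obtains C where "0 \<le> C"
    "\<And>c r E F. 0 < r \<Longrightarrow> E \<in> sets borel \<Longrightarrow> E \<subseteq> ball c r \<Longrightarrow> \<tau> * r ^ CARD('n) \<le> measure lborel E \<Longrightarrow>
       F \<in> sets borel \<Longrightarrow> F \<subseteq> ball c r \<Longrightarrow> \<tau> * r ^ CARD('n) \<le> measure lborel F \<Longrightarrow>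
       \<bar>median u E - median u F\<bar> \<le>
         C * (measure (energy_measure s p q u) (ball c r) / r powr (real CARD('n) - s * p)) powr (1 / p)"
proof -
  interpret finite_measure "energy_measure s p q u" by (rule fin)
  define N where "N = real CARD('n)"
  define v where "v = unit_ball_vol N"
  \<comment> \<open>Chosen so that, for a set of volume \<open>\<tau> r\<^sup>n\<close>, the energy \<open>\<gamma>\<close> below turns the hypothesis of the Chebyshev bound into an equality.\<close>
  define C1 where "C1 = (2 * 2 powr (N + s * q) / \<tau>) powr (1 / q)"
  have "0 < v" "0 < C1" using pos by (auto simp: v_def C1_def N_def)
  have close: "\<bar>median u E - median u F\<bar> \<le> 2 * t"
    if r: "0 < r" and E: "E \<in> sets borel" "E \<subseteq> ball c r" "\<tau> * r ^ CARD('n) \<le> measure lborel E"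
      and F: "F \<in> sets borel" "F \<subseteq> ball c r" "\<tau> * r ^ CARD('n) \<le> measure lborel F"
      and t: "0 < t" "measure (energy_measure s p q u) (ball c r) < v * r powr N * (t / (C1 * r powr s)) powr p"
    for c r E F t
  proof -
    \<comment> \<open>\<open>h = (t / (C1 r\<^sup>s))\<^sup>p\<close> is the bound for the density, and \<open>\<gamma> = h\<^bsup>q/p\<^esup>\<close> the corresponding bound for the energy.\<close>
    define \<gamma> where "\<gamma> = (t / (C1 * r powr s)) powr q"
    have "emeasure (energy_measure s p q u) (ball c r) <
        ennreal ((t / (C1 * r powr s)) powr p) * emeasure lborel (ball c r)"
      using t r \<open>0 < v\<close>
      by (simp add: emeasure_eq_measure emeasure_ball v_def N_def powr_realpow ennreal_mult[symmetric]
          ennreal_less_iff mult.commute)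
    then have "\<exists>z\<in>ball c r. ennpowr (frac_energy s q u z) (p / q) < ennreal ((t / (C1 * r powr s)) powr p)"
      unfolding energy_measure_def by (intro ex_less_of_density_less) simp_all
    then obtain z where z: "z \<in> ball c r"
      "ennpowr (frac_energy s q u z) (p / q) < ennreal ((t / (C1 * r powr s)) powr p)" ..
    have "frac_energy s q u z < ennreal (((t / (C1 * r powr s)) powr p) powr (1 / (p / q)))"
      using z(2) pos by (intro ennpowr_less_imp) auto
    then have energy: "frac_energy s q u z < ennreal \<gamma>"
      using pos by (simp add: \<gamma>_def powr_powr)
    have \<gamma>: "\<gamma> * (2 * r) powr (N + s * q) = t powr q * (\<tau> * r powr N / 2)"
    proof -
      have aux: "x / (2 * a / \<tau> * b) * (a * (b * y)) = x * (\<tau> * y / 2)"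
        if "0 < a" "0 < b" for a b x y :: real
        using that pos by (simp add: divide_simps)
      have "C1 powr q = 2 * 2 powr (N + s * q) / \<tau>"
        using pos by (simp add: C1_def powr_powr)
      then have "\<gamma> = t powr q / (2 * 2 powr (N + s * q) / \<tau> * (r powr s) powr q)"
        using r t \<open>0 < C1\<close> by (simp add: \<gamma>_def powr_divide powr_mult)
      moreover have "(2 * r) powr (N + s * q) = 2 powr (N + s * q) * ((r powr s) powr q * r powr N)"
        using r by (simp add: powr_mult powr_powr powr_add mult.commute)
      ultimately show ?thesis
        using r by (simp only:) (rule aux, auto)
    qed
    have med: "\<bar>median u X - u z\<bar> \<le> t"
      if X: "X \<in> sets borel" "X \<subseteq> ball c r" "\<tau> * r ^ CARD('n) \<le> measure lborel X" for X
    proof (rule median_close_of_frac_energy[where D = "2 * r" and \<gamma> = \<gamma> and s = s and q = q])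
      show "X \<subseteq> cball z (2 * r)"
      proof
        fix y assume "y \<in> X"
        then have "dist c y < r" "dist c z < r" using X z by auto
        then show "y \<in> cball z (2 * r)" using dist_triangle3[of z y c] by auto
      qed
      show "0 < measure lborel X" using X(3) r pos by (intro less_le_trans[OF _ X(3)]) auto
      have "t powr q * (\<tau> * r powr N / 2) \<le> t powr q * (measure lborel X / 2)"
        using X(3) r by (intro mult_left_mono divide_right_mono) (auto simp: N_def powr_realpow)
      with \<gamma> show "\<gamma> * (2 * r) powr (real CARD('n) + s * q) \<le> t powr q * (measure lborel X / 2)"
        by (simp add: N_def)
    qed (use X u pos t r energy in auto)
    show ?thesis using med[OF E] med[OF F] by linarith
  qed
  show thesis
  proof (rule that[of "2 * C1 / v powr (1 / p)"])
    show "0 \<le> 2 * C1 / v powr (1 / p)" using \<open>0 < C1\<close> by simp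
    fix c :: "real ^ 'n" and r :: real and E F
    assume r: "0 < r" and E: "E \<in> sets borel" "E \<subseteq> ball c r" "\<tau> * r ^ CARD('n) \<le> measure lborel E"
      and F: "F \<in> sets borel" "F \<subseteq> ball c r" "\<tau> * r ^ CARD('n) \<le> measure lborel F"
    define m where "m = measure (energy_measure s p q u) (ball c r)"
    define d where "d = real CARD('n) - s * p"
    define X where "X = C1 / v powr (1 / p) * (m / r powr d) powr (1 / p)"
    have "\<bar>median u E - median u F\<bar> / 2 \<le> X"
    proof (rule dense_ge)
      fix t assume "X < t"
      have "0 \<le> X" using \<open>0 < C1\<close> by (simp add: X_def)
      have "X powr p < t powr p" using \<open>X < t\<close> \<open>0 \<le> X\<close> pos by (intro powr_less_mono2) auto
      moreover have "X powr p = C1 powr p / v * (m / r powr d)"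
        using pos \<open>0 < C1\<close> \<open>0 < v\<close> by (simp add: X_def powr_mult powr_divide powr_powr m_def)
      ultimately have "C1 powr p / v * (m / r powr d) < t powr p" by simp
      then have "m < v * r powr d * (t powr p / C1 powr p)"
        using \<open>0 < C1\<close> \<open>0 < v\<close> r by (simp add: pos_divide_less_eq pos_less_divide_eq mult_ac)
      also have "\<dots> = v * r powr N * (t / (C1 * r powr s)) powr p"
        using \<open>0 < C1\<close> r \<open>0 \<le> X\<close> \<open>X < t\<close>
        by (simp add: powr_divide powr_mult powr_powr d_def N_def powr_diff)
      finally have "m < v * r powr N * (t / (C1 * r powr s)) powr p" .
      then have "\<bar>median u E - median u F\<bar> \<le> 2 * t"
        using \<open>0 \<le> X\<close> \<open>X < t\<close> by (intro close[OF r E F]) (auto simp: m_def)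
      then show "\<bar>median u E - median u F\<bar> / 2 \<le> t" by simp
    qed
    then show "\<bar>median u E - median u F\<bar> \<le> 2 * C1 / v powr (1 / p) *
        (measure (energy_measure s p q u) (ball c r) / r powr (real CARD('n) - s * p)) powr (1 / p)"
      by (simp add: X_def m_def d_def field_simps)
  qed
qed

section \<open>Chains of medians\<close>

lemma geometric_chain_le:
  fixes a :: "nat \<Rightarrow> real"
  assumes "\<And>i. i < j \<Longrightarrow> \<bar>a i - a (Suc i)\<bar> \<le> D * \<rho> ^ i" and "0 \<le> \<rho>" "\<rho> < 1" "0 \<le> D"
  shows "\<bar>a 0 - a j\<bar> \<le> D / (1 - \<rho>)"
proof -
  have "\<bar>a 0 - a j\<bar> = \<bar>\<Sum>i<j. a i - a (Suc i)\<bar>"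
    by (simp add: sum_lessThan_telescope')
  also have "\<dots> \<le> (\<Sum>i<j. D * \<rho> ^ i)"
    using assms(1) by (intro order_trans[OF sum_abs] sum_mono) auto
  also have "\<dots> = D * ((1 - \<rho> ^ j) / (1 - \<rho>))"
    using assms(3) by (simp add: sum_distrib_left[symmetric] sum_gp_strict)
  also have "\<dots> \<le> D * (1 / (1 - \<rho>))"
    using assms by (intro mult_left_mono divide_right_mono) auto
  finally show ?thesis by simp
qed

lemma ex_dyadic_below_one:
  fixes t :: real
  assumes "0 < t" "t < 1"
  obtains j where "(1/2) ^ Suc j \<le> t" "t < (1/2) ^ j"
proof -
  obtain k where "(1/2) ^ k \<le> t" using real_arch_pow_inv[of t "1/2"] assms by (auto intro: less_imp_le)
  then have least: "(1/2) ^ (LEAST k. (1/2) ^ k \<le> t) \<le> t" by (rule LeastI)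
  with assms have "(LEAST k. (1/2) ^ k \<le> t) \<noteq> 0" by (metis not_le power_0)
  then obtain j where j: "(LEAST k. (1/2) ^ k \<le> t) = Suc j" by (metis not0_implies_Suc)
  then have "\<not> (1/2) ^ j \<le> t" by (metis lessI not_less_Least)
  with least j show thesis by (intro that[of j]) auto
qed

lemma ex_dyadic_above_one:
  fixes t :: real
  assumes "1 \<le> t"
  obtains j where "2 ^ j \<le> t" "t < 2 ^ Suc j"
proof -
  obtain k where "t < 2 ^ k" using real_arch_pow[of 2 t] by auto
  then have least: "t < 2 ^ (LEAST k. t < 2 ^ k)" by (rule LeastI)
  with assms have "(LEAST k. t < 2 ^ k) \<noteq> 0" by (metis not_le power_0)
  then obtain j where j: "(LEAST k. t < 2 ^ k) = Suc j" by (metis not0_implies_Suc)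
  then have "\<not> t < 2 ^ j" by (metis lessI not_less_Least)
  with least j show thesis by (intro that[of j]) auto
qed

lemma ereal_dist_triangle:
  assumes "\<bar>x - ereal a\<bar> \<le> ereal t" "t + \<bar>a - b\<bar> < e"
  shows "\<bar>x - ereal b\<bar> < ereal e"
proof (cases x)
  case (real r)
  then have "\<bar>r - a\<bar> \<le> t" using assms(1) by simp
  then have "\<bar>r - b\<bar> < e" using assms(2) by linarith
  then show ?thesis using real by simp
qed (use assms(1) in auto)

text \<open>
  This collects what the later arguments use of \<open>u\<close>: the oscillation of its medians
  at scale \<open>r\<close> is governed by \<open>\<mu>(B) / r\<^sup>d\<close> for a finite
  measure \<open>\<mu>\<close>. In the application \<open>d = n - sp\<close>, and the positivity
  of \<open>d\<close> is the condition \<open>sp < n\<close>.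
\<close>

locale median_oscillation = finite_measure \<mu> for \<mu> :: "(real ^ 'n) measure" +
  fixes u :: "real ^ 'n \<Rightarrow> real" and d p :: real
  assumes sets_\<mu> [simp]: "sets \<mu> = sets borel" and d_pos: "0 < d" and p_pos: "0 < p"
    and oscillation: "\<And>\<tau>. 0 < \<tau> \<Longrightarrow> \<exists>C\<ge>0. \<forall>c r E F. 0 < r \<longrightarrow>
      E \<in> sets borel \<longrightarrow> E \<subseteq> ball c r \<longrightarrow> \<tau> * r ^ CARD('n) \<le> measure lborel E \<longrightarrow>
      F \<in> sets borel \<longrightarrow> F \<subseteq> ball c r \<longrightarrow> \<tau> * r ^ CARD('n) \<le> measure lborel F \<longrightarrow>
      \<bar>median u E - median u F\<bar> \<le> C * (measure \<mu> (ball c r) / r powr d) powr (1 / p)"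
begin

text \<open>
  The ratio \<open>8\<close> is large enough for the comparison of balls with consecutive dyadic
  radii, and of a ball around \<open>x\<close> with the ball of the same radius around the
  origin when \<open>\<bar>x\<bar>\<close> is at most four times the radius.
\<close>

lemma ball_oscillation:
  obtains C where "0 \<le> C"
    "\<And>c R x r y r'. 0 < R \<Longrightarrow> R / 8 \<le> r \<Longrightarrow> R / 8 \<le> r' \<Longrightarrow> ball x r \<subseteq> ball c R \<Longrightarrow> ball y r' \<subseteq> ball c R \<Longrightarrow>
      \<bar>median u (ball x r) - median u (ball y r')\<bar> \<le> C * (measure \<mu> (ball c R) / R powr d) powr (1 / p)"
proof -
  define v where "v = unit_ball_vol (real CARD('n))"
  have "0 < v" by (simp add: v_def)
  then obtain C where C: "0 \<le> C" "\<forall>c r E F. 0 < r \<longrightarrow>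
      E \<in> sets borel \<longrightarrow> E \<subseteq> ball c r \<longrightarrow> v / 8 ^ CARD('n) * r ^ CARD('n) \<le> measure lborel E \<longrightarrow>
      F \<in> sets borel \<longrightarrow> F \<subseteq> ball c r \<longrightarrow> v / 8 ^ CARD('n) * r ^ CARD('n) \<le> measure lborel F \<longrightarrow>
      \<bar>median u E - median u F\<bar> \<le> C * (measure \<mu> (ball c r) / r powr d) powr (1 / p)"
    using oscillation[of "v / 8 ^ CARD('n)"] by auto
  have vol: "v / 8 ^ CARD('n) * R ^ CARD('n) \<le> measure lborel (ball x r)"
    if "0 < R" "R / 8 \<le> r" for R r and x :: "real ^ 'n"
  proof -
    have "v * (R / 8) ^ CARD('n) \<le> v * r ^ CARD('n)"
      using that \<open>0 < v\<close> by (intro mult_left_mono power_mono) auto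
    then show ?thesis using that by (simp add: content_ball v_def power_divide)
  qed
  show thesis
    by (rule that[OF C(1)]) (use C(2) vol in simp)
qed

text \<open>
  Under the growth condition the oscillation at scale \<open>r = 2\<^bsup>-i\<^esup>\<close> is
  at most a multiple of \<open>\<eta>\<^bsup>1/p\<^esup> r\<^bsup>(l-d)/p\<^esup>\<close>. This
  is summable over \<open>i\<close> exactly because \<open>l > d\<close>. The chain runs from
  the unit ball down to the ball of the size of a given small cube around \<open>x\<close>, and
  one more comparison leads to the cube.
\<close>

lemma precise_rep_near_unit_ball_median:
  assumes "d < l"
  obtains C where "0 \<le> C"
    "\<And>x \<eta>. 0 \<le> \<eta> \<Longrightarrow> (\<And>r. 0 < r \<Longrightarrow> r \<le> 1 \<Longrightarrow> measure \<mu> (ball x r) \<le> \<eta> * r powr l) \<Longrightarrow>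
      \<bar>precise_rep u x - ereal (median u (ball x 1))\<bar> \<le> ereal (C * \<eta> powr (1 / p))"
proof -
  define N where "N = CARD('n)"
  have "0 < N" by (simp add: N_def)
  define v where "v = unit_ball_vol (real N)"
  have "0 < v" by (simp add: v_def)
  \<comment> \<open>One fraction that serves for the ball of radius \<open>r\<close> and for a cube of side at least \<open>r / (4 n)\<close>.\<close>
  define \<tau> where "\<tau> = min v ((1 / (4 * real N)) ^ N)"
  have "0 < \<tau>" using \<open>0 < v\<close> \<open>0 < N\<close> by (simp add: \<tau>_def)
  obtain C1 where C1: "0 \<le> C1"
    "\<And>c R x r y r'. 0 < R \<Longrightarrow> R / 8 \<le> r \<Longrightarrow> R / 8 \<le> r' \<Longrightarrow> ball x r \<subseteq> ball c R \<Longrightarrow> ball y r' \<subseteq> ball c R \<Longrightarrow>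
      \<bar>median u (ball x r) - median u (ball y r')\<bar> \<le> C1 * (measure \<mu> (ball c R) / R powr d) powr (1 / p)"
    by (rule ball_oscillation) blast
  obtain C2 where C2: "0 \<le> C2" "\<forall>c r E F. 0 < r \<longrightarrow>
      E \<in> sets borel \<longrightarrow> E \<subseteq> ball c r \<longrightarrow> \<tau> * r ^ CARD('n) \<le> measure lborel E \<longrightarrow>
      F \<in> sets borel \<longrightarrow> F \<subseteq> ball c r \<longrightarrow> \<tau> * r ^ CARD('n) \<le> measure lborel F \<longrightarrow>
      \<bar>median u E - median u F\<bar> \<le> C2 * (measure \<mu> (ball c r) / r powr d) powr (1 / p)"
    using oscillation[OF \<open>0 < \<tau>\<close>] by auto
  define \<alpha> where "\<alpha> = (l - d) / p"
  have "0 < \<alpha>" using assms p_pos by (simp add: \<alpha>_def)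
  define \<rho> where "\<rho> = (1/2::real) powr \<alpha>"
  have \<rho>: "0 \<le> \<rho>" "\<rho> < 1" using \<open>0 < \<alpha>\<close> powr_less_mono2[of \<alpha> "1/2" 1] by (auto simp: \<rho>_def)
  show thesis
  proof (rule that[of "C1 / (1 - \<rho>) + C2"])
    show "0 \<le> C1 / (1 - \<rho>) + C2" using C1(1) C2(1) \<rho> by simp
    fix x :: "real ^ 'n" and \<eta> :: real
    assume "0 \<le> \<eta>" and growth: "\<And>r. 0 < r \<Longrightarrow> r \<le> 1 \<Longrightarrow> measure \<mu> (ball x r) \<le> \<eta> * r powr l"
    have scale: "(measure \<mu> (ball x ((1/2) ^ i)) / ((1/2) ^ i) powr d) powr (1 / p) \<le> \<eta> powr (1 / p) * \<rho> ^ i" for i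
    proof -
      have "measure \<mu> (ball x ((1/2) ^ i)) / ((1/2) ^ i) powr d \<le> \<eta> * ((1/2) ^ i) powr l / ((1/2) ^ i) powr d"
        using growth[of "(1/2) ^ i"] by (intro divide_right_mono) (auto simp: power_le_one)
      also have "\<dots> = \<eta> * ((1/2) ^ i) powr (l - d)"
        by (simp add: powr_diff)
      finally have "(measure \<mu> (ball x ((1/2) ^ i)) / ((1/2) ^ i) powr d) powr (1 / p) \<le>
          (\<eta> * ((1/2) ^ i) powr (l - d)) powr (1 / p)"
        using p_pos by (intro powr_mono2) auto
      also have "\<dots> = \<eta> powr (1 / p) * ((1/2) ^ i) powr \<alpha>"
        using \<open>0 \<le> \<eta>\<close> by (simp add: powr_mult powr_powr \<alpha>_def)
      also have "((1/2::real) ^ i) powr \<alpha> = \<rho> ^ i"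
        by (simp add: \<rho>_def powr_realpow[symmetric] powr_powr mult.commute)
      finally show ?thesis .
    qed
    have chain: "\<bar>median u (ball x 1) - median u (ball x ((1/2) ^ j))\<bar> \<le> C1 * \<eta> powr (1 / p) / (1 - \<rho>)" for j
    proof -
      have "\<bar>median u (ball x ((1/2) ^ i)) - median u (ball x ((1/2) ^ Suc i))\<bar> \<le> C1 * \<eta> powr (1 / p) * \<rho> ^ i" for i
      proof -
        have "\<bar>median u (ball x ((1/2) ^ i)) - median u (ball x ((1/2) ^ Suc i))\<bar> \<le>
            C1 * (measure \<mu> (ball x ((1/2) ^ i)) / ((1/2) ^ i) powr d) powr (1 / p)"
          by (intro C1(2) subset_ball) auto
        also have "\<dots> \<le> C1 * (\<eta> powr (1 / p) * \<rho> ^ i)"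
          by (intro mult_left_mono scale C1(1))
        finally show ?thesis by (simp add: mult.assoc)
      qed
      from geometric_chain_le[of j "\<lambda>i. median u (ball x ((1/2) ^ i))", OF this \<rho>] C1(1)
      show ?thesis by simp
    qed
    show "\<bar>precise_rep u x - ereal (median u (ball x 1))\<bar> \<le> ereal ((C1 / (1 - \<rho>) + C2) * \<eta> powr (1 / p))"
    proof (rule precise_rep_close)
      \<comment> \<open>Cubes of smaller volume have side below \<open>1 / (2 n)\<close>, so that the ball around them has radius below \<open>1\<close>.\<close>
      show "0 < (1 / (2 * real N)) ^ N" using \<open>0 < N\<close> by simp
      fix Q :: "(real ^ 'n) set"
      assume Q: "half_open_cube Q" "x \<in> Q" "measure lebesgue Q < (1 / (2 * real N)) ^ N"
      obtain w where w: "0 < w" "Q \<in> sets borel" "measure lborel Q = w ^ N" "Q \<subseteq> ball x (2 * real N * w)"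
        using half_open_cubeE[OF Q(1)] Q(2) by (metis N_def)
      have "w < 1 / (2 * real N)"
        using w Q(3) by (intro power_less_imp_less_base[of w N]) auto
      then have "0 < 2 * real N * w" "2 * real N * w < 1" using w \<open>0 < N\<close> by (auto simp: field_simps)
      then obtain j where j: "(1/2) ^ Suc j \<le> 2 * real N * w" "2 * real N * w < (1/2) ^ j"
        by (rule ex_dyadic_below_one)
      have "\<tau> * ((1/2) ^ j) ^ N \<le> (1 / (4 * real N)) ^ N * ((1/2) ^ j) ^ N"
        by (intro mult_right_mono) (auto simp: \<tau>_def)
      also have "\<dots> = ((1/2) ^ j / (4 * real N)) ^ N" by (simp add: power_divide power_mult_distrib)
      also have "\<dots> \<le> w ^ N"
        using j(1) \<open>0 < N\<close> by (intro power_mono) (auto simp: field_simps)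
      finally have "\<tau> * ((1/2) ^ j) ^ CARD('n) \<le> measure lborel Q" using w by (simp add: N_def)
      moreover have "\<tau> * ((1/2) ^ j) ^ CARD('n) \<le> measure lborel (ball x ((1/2) ^ j))"
        by (subst content_ball) (auto simp: \<tau>_def v_def N_def intro!: mult_right_mono)
      moreover have "Q \<subseteq> ball x ((1/2) ^ j)"
        using w(4) j(2) by (meson less_imp_le order_trans subset_ball)
      ultimately have "\<bar>median u (ball x ((1/2) ^ j)) - median u Q\<bar> \<le>
          C2 * (measure \<mu> (ball x ((1/2) ^ j)) / ((1/2) ^ j) powr d) powr (1 / p)"
        using C2(2)[rule_format, of "(1/2) ^ j" "ball x ((1/2) ^ j)" x Q] w(2) by simp
      also have "\<dots> \<le> C2 * (\<eta> powr (1 / p) * \<rho> ^ j)"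
        by (intro mult_left_mono scale C2(1))
      also have "\<dots> \<le> C2 * (\<eta> powr (1 / p) * 1)"
        using C2(1) \<rho> by (intro mult_left_mono) (auto intro: power_le_one)
      finally have "\<bar>median u (ball x ((1/2) ^ j)) - median u Q\<bar> \<le> C2 * \<eta> powr (1 / p)" by simp
      moreover have "(C1 / (1 - \<rho>) + C2) * \<eta> powr (1 / p) =
          C1 * \<eta> powr (1 / p) / (1 - \<rho>) + C2 * \<eta> powr (1 / p)"
        by (simp add: algebra_simps)
      ultimately show "\<bar>median u Q - median u (ball x 1)\<bar> \<le> (C1 / (1 - \<rho>) + C2) * \<eta> powr (1 / p)"
        using chain[of j] by linarith
    qed
  qed
qed

text \<open>
  The factor \<open>r\<^bsup>-d/p\<^esup>\<close> makes the oscillations on large balls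
  summable, so the medians on the balls \<open>B(0,2\<^sup>i)\<close> converge. From a distant
  \<open>x\<close> one climbs with balls around \<open>x\<close> up to a radius comparable to
  \<open>\<bar>x\<bar>\<close>, where a comparison with the ball of the same radius around the
  origin is possible. The balls of this chain stay at distance at least
  \<open>\<bar>x\<bar>/2\<close> from the origin, so their measure is small: without this the
  sum over the small radii would not tend to zero.
\<close>

lemma unit_ball_medians_converge:
  obtains K where "((\<lambda>x. median u (ball x 1)) \<longlongrightarrow> K) at_infinity"
proof -
  obtain C where C: "0 \<le> C"
    "\<And>c R x r y r'. 0 < R \<Longrightarrow> R / 8 \<le> r \<Longrightarrow> R / 8 \<le> r' \<Longrightarrow> ball x r \<subseteq> ball c R \<Longrightarrow> ball y r' \<subseteq> ball c R \<Longrightarrow>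
      \<bar>median u (ball x r) - median u (ball y r')\<bar> \<le> C * (measure \<mu> (ball c R) / R powr d) powr (1 / p)"
    by (rule ball_oscillation) blast
  define \<sigma> where "\<sigma> = (1/2::real) powr (d / p)"
  have \<sigma>: "0 < \<sigma>" "\<sigma> < 1"
    using d_pos p_pos powr_less_mono2[of "d / p" "1/2" 1] by (auto simp: \<sigma>_def)
  have scale: "(measure \<mu> X / (2 ^ i) powr d) powr (1 / p) = measure \<mu> X powr (1 / p) * \<sigma> ^ i" for X i
  proof -
    have "((2 ^ i) powr d) powr (1 / p) = 1 / \<sigma> ^ i"
      by (simp add: \<sigma>_def powr_realpow[symmetric] powr_powr powr_divide mult_ac)
    then show ?thesis by (simp add: powr_divide)
  qed
  define m where "m = measure \<mu> UNIV powr (1 / p)"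
  have dyadic: "\<bar>median u (ball x r) - median u (ball y r')\<bar> \<le> C * m * \<sigma> ^ i"
    if "2 ^ i / 8 \<le> r" "2 ^ i / 8 \<le> r'" "ball x r \<subseteq> ball c (2 ^ i)" "ball y r' \<subseteq> ball c (2 ^ i)" for x y c r r' i
  proof -
    have "\<bar>median u (ball x r) - median u (ball y r')\<bar> \<le> C * (measure \<mu> (ball c (2 ^ i)) powr (1 / p) * \<sigma> ^ i)"
      unfolding scale[symmetric] using that by (intro C(2)) auto
    also have "\<dots> \<le> C * (m * \<sigma> ^ i)"
      unfolding m_def using C(1) \<sigma> p_pos
      by (intro mult_left_mono mult_right_mono powr_mono2 finite_measure_mono) auto
    finally show ?thesis by (simp add: mult.assoc)
  qed
  define a where "a i = median u (ball 0 (2 ^ i))" for i :: nat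
  have step: "norm (a (Suc i) - a i) \<le> C * m * \<sigma> * \<sigma> ^ i" for i
    unfolding a_def using dyadic[of "Suc i" "2 ^ Suc i" "2 ^ i" 0 0 0]
    by (simp add: subset_ball mult.assoc)
  have "summable (\<lambda>i. C * m * \<sigma> * \<sigma> ^ i)"
    using \<sigma> by (intro summable_mult summable_geometric) auto
  then have "summable (\<lambda>i. a (Suc i) - a i)"
    by (rule summable_comparison_test') (rule step)
  then have "convergent (\<lambda>n. a n - a 0)"
    unfolding summable_iff_convergent sum_lessThan_telescope .
  then have "convergent a" by (simp add: convergent_diff_const_right_iff)
  then obtain K where K: "a \<longlonglongrightarrow> K" by (auto simp: convergent_def)
  define T where "T k = C * measure \<mu> (- ball 0 (real k)) powr (1 / p) / (1 - \<sigma>)" for k :: nat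
  have "T \<longlonglongrightarrow> C * 0 / (1 - \<sigma>)"
    unfolding T_def using p_pos \<sigma> finite_measure_axioms
    by (intro tendsto_intros tendsto_zero_powrI[OF tendsto_measure_outside_ball tendsto_const]) auto
  then have T: "T \<longlonglongrightarrow> 0" by simp
  have "((\<lambda>x. median u (ball x 1)) \<longlongrightarrow> K) at_infinity"
  proof (rule tendstoI)
    fix e :: real assume "0 < e"
    have "(\<lambda>i. C * m * \<sigma> ^ i) \<longlonglongrightarrow> C * m * 0"
      using \<sigma> by (intro tendsto_intros LIMSEQ_power_zero) auto
    then have "eventually (\<lambda>i. C * m * \<sigma> ^ i < e / 3) sequentially"
      using \<open>0 < e\<close> by (intro order_tendstoD) auto
    moreover have "eventually (\<lambda>i. \<bar>a i - K\<bar> < e / 3) sequentially"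
      using tendstoD[OF K, of "e / 3"] \<open>0 < e\<close> by (auto simp: dist_real_def)
    ultimately have "eventually (\<lambda>i. C * m * \<sigma> ^ i < e / 3 \<and> \<bar>a i - K\<bar> < e / 3) sequentially"
      by (rule eventually_conj)
    then obtain J0 where J0: "\<And>i. J0 \<le> i \<Longrightarrow> C * m * \<sigma> ^ i < e / 3" "\<And>i. J0 \<le> i \<Longrightarrow> \<bar>a i - K\<bar> < e / 3"
      by (auto simp: eventually_sequentially)
    have "eventually (\<lambda>k. T k < e / 3) sequentially"
      using T \<open>0 < e\<close> by (intro order_tendstoD) auto
    then obtain k where k: "T k < e / 3" by (auto simp: eventually_sequentially)
    have "dist (median u (ball x 1)) K < e" if x: "2 * max (2 ^ J0) (real k) \<le> norm x" for x
    proof -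
      have "2 ^ J0 \<le> norm x / 2" "real k \<le> norm x / 2" using x by auto
      moreover have "(1::real) \<le> 2 ^ J0" by simp
      ultimately have "1 \<le> norm x / 2" by linarith
      then obtain J where J: "2 ^ J \<le> norm x / 2" "norm x / 2 < 2 ^ Suc J"
        by (rule ex_dyadic_above_one)
      have "(2::real) ^ J0 < 2 ^ Suc J" using J(2) \<open>2 ^ J0 \<le> norm x / 2\<close> by linarith
      then have "J0 < Suc J" by (simp only: power_strict_increasing_iff)
      then have "J0 \<le> J" by simp
      have "\<bar>median u (ball x (2 ^ 0)) - median u (ball x (2 ^ J))\<bar> \<le>
          (C * measure \<mu> (- ball 0 (real k)) powr (1 / p)) / (1 - \<sigma>)"
      proof (rule geometric_chain_le[where a = "\<lambda>i. median u (ball x (2 ^ i))"])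
        fix i assume "i < J"
        have "ball x (2 ^ Suc i) \<subseteq> - ball 0 (real k)"
        proof
          fix y assume "y \<in> ball x (2 ^ Suc i)"
          then have "norm (x - y) < 2 ^ Suc i" by (simp add: dist_norm)
          moreover have "(2::real) ^ Suc i \<le> 2 ^ J" using \<open>i < J\<close> by (intro power_increasing) auto
          ultimately have "real k \<le> norm y"
            using J(1) \<open>real k \<le> norm x / 2\<close> norm_triangle_ineq2[of x y] by linarith
          then show "y \<in> - ball 0 (real k)" by simp
        qed
        then have "measure \<mu> (ball x (2 ^ Suc i)) \<le> measure \<mu> (- ball 0 (real k))"
          by (intro finite_measure_mono) auto
        then have "measure \<mu> (ball x (2 ^ Suc i)) powr (1 / p) \<le> measure \<mu> (- ball 0 (real k)) powr (1 / p)"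
          using p_pos by (intro powr_mono2) auto
        then have "C * (measure \<mu> (ball x (2 ^ Suc i)) powr (1 / p) * \<sigma> ^ Suc i) \<le>
            C * (measure \<mu> (- ball 0 (real k)) powr (1 / p) * \<sigma> ^ i)"
          using C(1) \<sigma> by (intro mult_left_mono mult_mono power_decreasing) auto
        moreover have "\<bar>median u (ball x (2 ^ i)) - median u (ball x (2 ^ Suc i))\<bar> \<le>
            C * (measure \<mu> (ball x (2 ^ Suc i)) powr (1 / p) * \<sigma> ^ Suc i)"
          unfolding scale[symmetric] by (intro C(2) subset_ball) auto
        ultimately show "\<bar>median u (ball x (2 ^ i)) - median u (ball x (2 ^ Suc i))\<bar> \<le>
            C * measure \<mu> (- ball 0 (real k)) powr (1 / p) * \<sigma> ^ i"
          by (simp add: mult.assoc)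
      qed (use \<sigma> C(1) in auto)
      then have 1: "\<bar>median u (ball x 1) - median u (ball x (2 ^ J))\<bar> < e / 3"
        using k unfolding T_def power_0 by linarith
      have "ball x (2 ^ J) \<subseteq> ball 0 (2 ^ (J + 3))"
      proof
        fix y assume "y \<in> ball x (2 ^ J)"
        then have "norm (y - x) < 2 ^ J" by (simp add: dist_norm norm_minus_commute)
        moreover have "(2::real) ^ Suc J = 2 * 2 ^ J" "(2::real) ^ (J + 3) = 8 * 2 ^ J" "(0::real) < 2 ^ J"
          by (auto simp: power_add)
        ultimately have "norm y < 2 ^ (J + 3)"
          using J(2) norm_triangle_ineq2[of y x] by linarith
        then show "y \<in> ball 0 (2 ^ (J + 3))" by simp
      qed
      moreover have "ball (0 :: real ^ 'n) (2 ^ J) \<subseteq> ball 0 (2 ^ (J + 3))"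
        by (intro subset_ball power_increasing) auto
      ultimately have "\<bar>median u (ball x (2 ^ J)) - a J\<bar> \<le> C * m * \<sigma> ^ (J + 3)"
        unfolding a_def by (intro dyadic) (auto simp: power_add)
      then have 2: "\<bar>median u (ball x (2 ^ J)) - a J\<bar> < e / 3"
        using J0(1)[of "J + 3"] \<open>J0 \<le> J\<close> by simp
      show ?thesis
        using 1 2 J0(2)[OF \<open>J0 \<le> J\<close>] unfolding dist_real_def by linarith
    qed
    then show "eventually (\<lambda>x. dist (median u (ball x 1)) K < e) at_infinity"
      unfolding eventually_at_infinity by blast
  qed
  then show thesis by (rule that)
qed

text \<open>
  A point far away where the precise representative deviates from the limit \<open>K\<close> of
  the unit ball medians must violate the growth condition \<open>\<mu>(B(x,r)) \<le> \<eta>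
  r\<^sup>l\<close> for a suitable \<open>\<eta>\<close> that depends only on \<open>l\<close>
  and the tolerance.
\<close>

lemma ex_thin_limit:
  "\<exists>K E. (\<forall>l>d. (\<lambda>m::nat. hausdorff_content l (E \<inter> - ball 0 (real m))) \<longlonglongrightarrow> 0) \<and>
    has_limit_outside (precise_rep u) E K"
proof -
  obtain K where K: "((\<lambda>x. median u (ball x 1)) \<longlongrightarrow> K) at_infinity"
    by (rule unit_ball_medians_converge)
  have "\<exists>E. (\<forall>l>d. (\<lambda>m::nat. hausdorff_content l (E \<inter> - ball 0 (real m))) \<longlonglongrightarrow> 0) \<and>
    has_limit_outside (precise_rep u) E K"
  proof (rule ex_thin_exceptional_set)
    fix l e :: real assume "d < l" "0 < e"
    obtain C where C: "0 \<le> C"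
      "\<And>x \<eta>. 0 \<le> \<eta> \<Longrightarrow> (\<And>r. 0 < r \<Longrightarrow> r \<le> 1 \<Longrightarrow> measure \<mu> (ball x r) \<le> \<eta> * r powr l) \<Longrightarrow>
        \<bar>precise_rep u x - ereal (median u (ball x 1))\<bar> \<le> ereal (C * \<eta> powr (1 / p))"
      using precise_rep_near_unit_ball_median[OF \<open>d < l\<close>] by blast
    \<comment> \<open>The \<open>1\<close> guards against \<open>C = 0\<close>.\<close>
    define b where "b = C + 1"
    have b: "0 < b" "C < b" using C(1) by (auto simp: b_def)
    define \<eta> where "\<eta> = (e / (2 * b)) powr p"
    have "0 < \<eta>" using \<open>0 < e\<close> b by (simp add: \<eta>_def)
    have "C * \<eta> powr (1 / p) < b * \<eta> powr (1 / p)"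
      using b \<open>0 < \<eta>\<close> by (intro mult_strict_right_mono) auto
    also have "\<dots> = e / 2"
      using \<open>0 < e\<close> b p_pos by (simp add: \<eta>_def powr_powr)
    finally have \<eta>: "C * \<eta> powr (1 / p) < e / 2" .
    have "eventually (\<lambda>x. dist (median u (ball x 1)) K < e / 2) at_infinity"
      using \<open>0 < e\<close> by (intro tendstoD[OF K]) auto
    then obtain R where R: "\<And>x. R \<le> norm x \<Longrightarrow> \<bar>median u (ball x 1) - K\<bar> < e / 2"
      by (auto simp: eventually_at_infinity dist_real_def)
    define bad where "bad m = {x. real m \<le> norm x \<and> (\<exists>r. 0 < r \<and> r \<le> 1 \<and> \<eta> * r powr l < measure \<mu> (ball x r))}" for m
    have dev_bad: "{x. \<not> \<bar>precise_rep u x - ereal K\<bar> < ereal e} \<inter> - ball 0 (real m) \<subseteq> bad m" if "R \<le> real m" for m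
    proof (rule subsetI, rule ccontr)
      fix x assume x: "x \<in> {x. \<not> \<bar>precise_rep u x - ereal K\<bar> < ereal e} \<inter> - ball 0 (real m)" and "x \<notin> bad m"
      then have "measure \<mu> (ball x r) \<le> \<eta> * r powr l" if "0 < r" "r \<le> 1" for r
        using that by (auto simp: bad_def not_less)
      then have "\<bar>precise_rep u x - ereal (median u (ball x 1))\<bar> \<le> ereal (C * \<eta> powr (1 / p))"
        using \<open>0 < \<eta>\<close> by (intro C(2)) auto
      moreover have "\<bar>median u (ball x 1) - K\<bar> < e / 2"
        using x \<open>R \<le> real m\<close> by (intro R) auto
      ultimately have "\<bar>precise_rep u x - ereal K\<bar> < ereal e"
        using \<eta> by (intro ereal_dist_triangle[of _ "median u (ball x 1)" "C * \<eta> powr (1 / p)"]) auto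
      with x show False by simp
    qed
    have le: "hausdorff_content l ({x. \<not> \<bar>precise_rep u x - ereal K\<bar> < ereal e} \<inter> - ball 0 (real (Suc m))) \<le>
        ennreal (10 powr l / \<eta> * measure \<mu> (- ball 0 (real m)))" if "R \<le> real m" for m
    proof -
      have "hausdorff_content l ({x. \<not> \<bar>precise_rep u x - ereal K\<bar> < ereal e} \<inter> - ball 0 (real (Suc m))) \<le>
          hausdorff_content l (bad (Suc m))"
        using that by (intro hausdorff_content_mono dev_bad) simp
      also have "\<dots> \<le> ennreal (10 powr l / \<eta> * measure \<mu> (- ball 0 (real (Suc m) - 1)))"
        unfolding bad_def using d_pos \<open>d < l\<close>
        by (intro hausdorff_content_large_ball_measure finite_measure_axioms sets_\<mu> \<open>0 < \<eta>\<close>) simp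
      finally show ?thesis by simp
    qed
    have "(\<lambda>m. ennreal (10 powr l / \<eta> * measure \<mu> (- ball 0 (real m)))) \<longlonglongrightarrow> ennreal (10 powr l / \<eta> * 0)"
      by (intro tendsto_ennrealI tendsto_mult tendsto_const tendsto_measure_outside_ball finite_measure_axioms sets_\<mu>)
    then have lim: "(\<lambda>m. ennreal (10 powr l / \<eta> * measure \<mu> (- ball 0 (real m)))) \<longlonglongrightarrow> 0" by simp
    obtain m0 :: nat where m0: "R \<le> real m0" using real_arch_simple by blast
    have "eventually (\<lambda>m. R \<le> real m) sequentially"
      using eventually_ge_at_top[of m0] by eventually_elim (use m0 in linarith)
    then have "eventually (\<lambda>m. hausdorff_content l ({x. \<not> \<bar>precise_rep u x - ereal K\<bar> < ereal e} \<inter> - ball 0 (real (Suc m))) \<le>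
        ennreal (10 powr l / \<eta> * measure \<mu> (- ball 0 (real m)))) sequentially"
      by eventually_elim (rule le)
    then have "(\<lambda>m. hausdorff_content l ({x. \<not> \<bar>precise_rep u x - ereal K\<bar> < ereal e} \<inter> - ball 0 (real (Suc m)))) \<longlonglongrightarrow> 0"
      by (intro tendsto_sandwich[OF _ _ tendsto_const lim]) auto
    then show "(\<lambda>m::nat. hausdorff_content l ({x. \<not> \<bar>precise_rep u x - ereal K\<bar> < ereal e} \<inter> - ball 0 (real m))) \<longlonglongrightarrow> 0"
      by (rule LIMSEQ_imp_Suc)
  qed (use d_pos in simp)
  then show ?thesis ..
qed

end

section \<open>Existence and uniqueness of the thin limit\<close>

text \<open>
  Changing \<open>u\<close> on a null set changes neither its medians nor its seminorm. Passing
  to a Borel function makes the energy a measurable function by Tonelli's theorem, and thus a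
  density.
\<close>

lemma Wdot_borel_representative:
  fixes f :: "real ^ 'n \<Rightarrow> ereal"
  assumes "f \<in> Wdot s p q"
  obtains u where "u \<in> borel_measurable borel" "f = precise_rep u" "finite_measure (energy_measure s p q u)"
proof -
  obtain u0 :: "real ^ 'n \<Rightarrow> real" where u0: "u0 \<in> borel_measurable lebesgue" "W_seminorm s p q u0 < top" "f = precise_rep u0"
    using assms unfolding Wdot_def by auto
  obtain u where u: "u \<in> borel_measurable borel" and AE: "AE x in lborel. u0 x = u x"
    using completion_ex_borel_measurable_real[OF u0(1)] by auto
  have [measurable]: "u \<in> borel_measurable borel" by (fact u)
  have "median u0 Q = median u Q" if Q: "half_open_cube Q" for Q
  proof (rule median_cong_AE)
    show "AE x in lebesgue. u0 x = u x" using AE by (rule AE_completion)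
    show "Q \<in> sets lebesgue" using half_open_cubeE[OF Q] by (metis sets_completionI_sets sets_lborel)
    show "u \<in> borel_measurable lebesgue" using u by (intro measurable_completion) simp
  qed (rule u0)
  then have "precise_rep u0 = precise_rep u"
    unfolding precise_rep_def by (intro ext INF_cong SUP_cong) auto
  moreover have "finite_measure (energy_measure s p q u)"
  proof
    let ?I = "\<lambda>u x. \<integral>\<^sup>+ y. ennreal (\<bar>u x - u y\<bar> powr q / norm (x - y) powr (real CARD('n) + s * q)) \<partial>lborel"
    have "AE x in lborel. ?I u0 x = frac_energy s q u x"
      using AE
    proof eventually_elim
      case (elim x)
      show ?case unfolding frac_energy_def elim
        by (intro nn_integral_cong_AE) (use AE in eventually_elim, auto)
    qed
    then have "AE x in lborel. ennpowr (?I u0 x) (p / q) = ennpowr (frac_energy s q u x) (p / q)"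
      by eventually_elim simp
    then have "(\<integral>\<^sup>+ x. ennpowr (frac_energy s q u x) (p / q) \<partial>lborel) = (\<integral>\<^sup>+ x. ennpowr (?I u0 x) (p / q) \<partial>lborel)"
      by (intro nn_integral_cong_AE) auto
    also have "\<dots> \<noteq> top"
      using u0(2) unfolding W_seminorm_def nn_integral_completion by (auto simp: ennpowr_def)
    finally show "emeasure (energy_measure s p q u) (space (energy_measure s p q u)) \<noteq> \<infinity>"
      by (simp add: energy_measure_def emeasure_density)
  qed
  ultimately show thesis using u u0(3) by (intro that) auto
qed

lemma Wdot_has_thin_limit:
  fixes f :: "real ^ 'n \<Rightarrow> ereal"
  assumes f: "f \<in> Wdot s p q" and pos: "0 < s" "0 < p" "0 < q" and subcritical: "s * p < real CARD('n)"
  shows "\<exists>K. has_thin_limit p s f K"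
proof -
  obtain u where u: "u \<in> borel_measurable borel" "f = precise_rep u" and fin: "finite_measure (energy_measure s p q u)"
    using Wdot_borel_representative[OF f] by blast
  interpret median_oscillation "energy_measure s p q u" u "real CARD('n) - s * p" p
  proof (intro median_oscillation.intro[OF fin] median_oscillation_axioms.intro)
    fix \<tau> :: real assume "0 < \<tau>"
    from median_oscillation_le[OF u(1) pos this fin]
    show "\<exists>C\<ge>0. \<forall>c r E F. 0 < r \<longrightarrow>
      E \<in> sets borel \<longrightarrow> E \<subseteq> ball c r \<longrightarrow> \<tau> * r ^ CARD('n) \<le> measure lborel E \<longrightarrow>
      F \<in> sets borel \<longrightarrow> F \<subseteq> ball c r \<longrightarrow> \<tau> * r ^ CARD('n) \<le> measure lborel F \<longrightarrow>
      \<bar>median u E - median u F\<bar> \<le>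
        C * (measure (energy_measure s p q u) (ball c r) / r powr (real CARD('n) - s * p)) powr (1 / p)"
      by metis
  qed (use subcritical pos in \<open>auto simp: energy_measure_def\<close>)
  show ?thesis
    using ex_thin_limit unfolding has_thin_limit_def thin_at_infinity_def u(2) by blast
qed

text \<open>
  With two different limits the two exceptional sets would together cover the complement of a
  ball, which has infinite \<open>n\<close>-dimensional content. The exponent \<open>n\<close>
  is one of those in the definition of thinness because \<open>sp > 0\<close>.
\<close>

lemma has_thin_limit_unique:
  fixes f :: "real ^ 'n \<Rightarrow> ereal"
  assumes "has_thin_limit p s f K1" "has_thin_limit p s f K2" and "0 < s * p"
  shows "K1 = K2"
proof (rule ccontr)
  assume "K1 \<noteq> K2"
  define e where "e = \<bar>K1 - K2\<bar> / 2"
  have "0 < e" using \<open>K1 \<noteq> K2\<close> by (simp add: e_def)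
  obtain E1 E2 where thin: "thin_at_infinity p s E1" "thin_at_infinity p s E2"
    and lim: "has_limit_outside f E1 K1" "has_limit_outside f E2 K2"
    using assms unfolding has_thin_limit_def by auto
  obtain R1 where R1: "\<And>x. x \<notin> E1 \<Longrightarrow> R1 < norm x \<Longrightarrow> \<bar>f x - ereal K1\<bar> < ereal e"
    using lim(1)[unfolded has_limit_outside_def, rule_format, OF \<open>0 < e\<close>] by blast
  obtain R2 where R2: "\<And>x. x \<notin> E2 \<Longrightarrow> R2 < norm x \<Longrightarrow> \<bar>f x - ereal K2\<bar> < ereal e"
    using lim(2)[unfolded has_limit_outside_def, rule_format, OF \<open>0 < e\<close>] by blast
  have cover: "x \<in> E1 \<union> E2" if "max R1 R2 < norm x" for x
  proof (rule ccontr)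
    assume "x \<notin> E1 \<union> E2"
    with R1[of x] R2[of x] that have "\<bar>f x - ereal K1\<bar> < ereal e" "\<bar>f x - ereal K2\<bar> < ereal e" by auto
    then obtain r where "\<bar>r - K1\<bar> < e" "\<bar>r - K2\<bar> < e" by (cases "f x") auto
    then show False unfolding e_def by (simp add: abs_if split: if_splits)
  qed
  define l where "l = real CARD('n)"
  have "(\<lambda>m::nat. hausdorff_content l (E1 \<inter> - ball 0 (real m)) + hausdorff_content l (E2 \<inter> - ball 0 (real m)))
      \<longlonglongrightarrow> 0 + 0"
    using thin \<open>0 < s * p\<close> unfolding thin_at_infinity_def by (intro tendsto_add) (auto simp: l_def mult.commute)
  then have "eventually (\<lambda>m::nat. hausdorff_content l (E1 \<inter> - ball 0 (real m)) +
      hausdorff_content l (E2 \<inter> - ball 0 (real m)) < top) sequentially"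
    by (rule order_tendstoD) simp
  then obtain m0 where m0: "\<And>m. m0 \<le> m \<Longrightarrow> hausdorff_content l (E1 \<inter> - ball 0 (real m)) +
      hausdorff_content l (E2 \<inter> - ball 0 (real m)) < top"
    by (auto simp: eventually_sequentially)
  obtain m1 :: nat where "max R1 R2 < real m1" using reals_Archimedean2 by blast
  define m where "m = max m0 m1"
  have m: "m0 \<le> m" "max R1 R2 < real m" using \<open>max R1 R2 < real m1\<close> by (auto simp: m_def)
  have "- ball 0 (real m) \<subseteq> (E1 \<inter> - ball 0 (real m)) \<union> (E2 \<inter> - ball 0 (real m))"
    using cover m(2) by force
  then have "hausdorff_content l (- ball (0 :: real ^ 'n) (real m)) \<le>
      hausdorff_content l (E1 \<inter> - ball 0 (real m)) + hausdorff_content l (E2 \<inter> - ball 0 (real m))"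
    by (rule order_trans[OF hausdorff_content_mono hausdorff_content_Un_le])
  also have "\<dots> < top" by (rule m0[OF m(1)])
  finally show False
    using hausdorff_content_outside_ball[of "real m", where 'a = "real ^ 'n"] by (simp add: l_def)
qed

section \<open>Limits along normal planes\<close>

text \<open>
  The exceptional base points are those whose normal plane meets \<open>E\<close> outside every
  ball. Choosing for each of them a point of \<open>E\<close> in its plane outside
  \<open>B(0,m)\<close> gives an expanding map into \<open>E - B(0,m)\<close>, by Pythagoras.
  The assumption on the dimension of \<open>V\<close> says that thinness holds with the exponent
  \<open>dim V\<close>.
\<close>

lemma thin_limit_along_normal_planes:
  fixes f :: "real ^ 'n \<Rightarrow> ereal"
  assumes "has_thin_limit p s f K" and "subspace V"
    and "0 < dim V" "real CARD('n) - s * p < real (dim V)"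
  shows "almost_every_normal_plane V (\<lambda>P. has_limit_along f P K)"
proof -
  obtain E where thin: "thin_at_infinity p s E" and lim: "has_limit_outside f E K"
    using assms(1) unfolding has_thin_limit_def by auto
  define F where "F = {x \<in> V. \<forall>m::nat. \<exists>y\<in>normal_plane x V. y \<in> E \<and> real m \<le> norm y}"
  have "hausdorff_content (real (dim V)) F \<le> hausdorff_content (real (dim V)) (E \<inter> - ball 0 (real m))" for m :: nat
  proof -
    have "\<forall>x\<in>F. \<exists>y\<in>normal_plane x V. y \<in> E \<and> real m \<le> norm y" by (auto simp: F_def)
    then obtain g where g: "\<And>x. x \<in> F \<Longrightarrow> g x \<in> normal_plane x V" "\<And>x. x \<in> F \<Longrightarrow> g x \<in> E \<and> real m \<le> norm (g x)"
      by metis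
    show ?thesis
    proof (rule hausdorff_content_le_of_expanding[where f = g])
      show "g x \<in> E \<inter> - ball 0 (real m)" if "x \<in> F" for x using g(2)[OF that] by simp
      show "dist x y \<le> dist (g x) (g y)" if "x \<in> F" "y \<in> F" for x y
      proof -
        obtain a b where ab: "a \<in> V\<^sup>\<bottom>" "b \<in> V\<^sup>\<bottom>" "g x = x + a" "g y = y + b"
          using g(1)[OF \<open>x \<in> F\<close>] g(1)[OF \<open>y \<in> F\<close>] by (auto simp: normal_plane_def)
        have "x - y \<in> V" using \<open>x \<in> F\<close> \<open>y \<in> F\<close> \<open>subspace V\<close> by (auto simp: F_def subspace_diff)
        moreover have "a - b \<in> V\<^sup>\<bottom>" using ab subspace_orthogonal_comp subspace_diff by blast
        ultimately have "orthogonal (x - y) (a - b)" by (auto simp: orthogonal_comp_def)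
        then have "(norm ((x - y) + (a - b)))\<^sup>2 = (norm (x - y))\<^sup>2 + (norm (a - b))\<^sup>2"
          by (rule norm_add_Pythagorean)
        then have "(norm (x - y))\<^sup>2 \<le> (norm ((x - y) + (a - b)))\<^sup>2" by simp
        then have "norm (x - y) \<le> norm ((x - y) + (a - b))" by (rule power2_le_imp_le) simp
        then show ?thesis by (simp add: dist_norm ab algebra_simps)
      qed
    qed simp
  qed
  moreover have "(\<lambda>m::nat. hausdorff_content (real (dim V)) (E \<inter> - ball 0 (real m))) \<longlonglongrightarrow> 0"
    using thin assms(3,4) unfolding thin_at_infinity_def by simp
  ultimately have "hausdorff_content (real (dim V)) F \<le> 0"
    by (intro LIMSEQ_le_const) auto
  then have "hausdorff_measure (real (dim V)) F = 0"
    using assms(3) by (intro hausdorff_measure_eq_0_of_content) auto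
  moreover have "has_limit_along f (normal_plane x V) K" if "x \<in> V - F" for x
    unfolding has_limit_along_def
  proof (intro allI impI)
    fix e :: real assume "0 < e"
    obtain m :: nat where m: "\<And>y. y \<in> normal_plane x V \<Longrightarrow> y \<in> E \<Longrightarrow> norm y < real m"
      using \<open>x \<in> V - F\<close> by (auto simp: F_def not_le)
    obtain R where R: "0 < R" "\<And>y. y \<notin> E \<Longrightarrow> R < norm y \<Longrightarrow> \<bar>f y - ereal K\<bar> < ereal e"
      using lim[unfolded has_limit_outside_def, rule_format, OF \<open>0 < e\<close>] by blast
    have "\<bar>f y - ereal K\<bar> < ereal e" if "y \<in> normal_plane x V" "max R (real m) < norm y" for y
      using m[of y] R(2)[of y] that by auto
    then show "\<exists>R>0. \<forall>y\<in>normal_plane x V. R < norm y \<longrightarrow> \<bar>f y - ereal K\<bar> < ereal e"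
      using R(1) by (intro exI[of _ "max R (real m)"]) auto
  qed
  ultimately show ?thesis
    unfolding almost_every_normal_plane_def by (intro exI[of _ F]) (auto simp: F_def)
qed

theorem corollary1p3:
  fixes s p q :: real and k :: nat and ustar :: "real ^ 'n \<Rightarrow> ereal"
  assumes "CARD('n) \<ge> 2"
    and "0 < s" and "s < 1"
    and "0 < p" and "0 < q"
    and "1 \<le> k" and "real k < s * p" and "s * p < real CARD('n)"
    and "ustar \<in> Wdot s p q"
  shows "(\<exists>!K. has_thin_limit p s ustar K) \<and>
    (\<forall>K V. has_thin_limit p s ustar K \<longrightarrow> subspace V \<longrightarrow> dim V = CARD('n) - k \<longrightarrow>
       almost_every_normal_plane V (\<lambda>P. has_limit_along ustar P K))"
proof (intro conjI allI impI)
  have "0 < s * p" using assms by simp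
  then show "\<exists>!K. has_thin_limit p s ustar K"
    using Wdot_has_thin_limit[of ustar s p q] has_thin_limit_unique[of p s ustar] assms by blast
  fix K and V :: "(real ^ 'n) set"
  assume "has_thin_limit p s ustar K" "subspace V" "dim V = CARD('n) - k"
  moreover have "real k < real CARD('n)" using assms by linarith
  then have "k < CARD('n)" by simp
  ultimately show "almost_every_normal_plane V (\<lambda>P. has_limit_along ustar P K)"
    using assms by (intro thin_limit_along_normal_planes) (auto simp: of_nat_diff)
qed

end
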